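(* Let $\alpha,\beta\in[0,2\pi)$ with $\beta\notin\{\alpha,\alpha\pm\pi\}$, and let $$u=\frac{1}{\sqrt2}\begin{bmatrix}1&1\\ e^{i\alpha}&-e^{i\alpha}\end{bmatrix},\qquad v=\frac{1}{\sqrt2}\begin{bmatrix}1&1\\ e^{i\beta}&-e^{i\beta}\end{bmatrix}.$$ Then the Pimsner-Popa constant of the pair of spin model subfactors $R_u,R_v\subset R$ is $\lambda(R_u,R_v)=\frac12$.
   Context: Spin model subfactors (for $n=2$). $M_n$ is the algebra of complex $n\times n$ matrices, $\Delta_n\subset M_n$ the diagonal subalgebra, $E_{ij}$ the matrix units, $J_n=\frac1n\sum_{i,j}E_{ij}$. A complex Hadamard matrix means here a unitary $u\in M_n$ all of whose entries have modulus $1/\sqrt n$. Consider the tower $A_{-1}=\Delta_n\subset A_0=M_n\subset A_1=\Delta_n\otimes M_n\subset A_2=M_n\otimes M_n\subset\cdots$, i.e. $A_{2k}=M_n^{\otimes (k+1)}$, $A_{2k+1}=\Delta_n\otimes M_n^{\otimes(k+1)}$, where $A_{2k}\subset A_{2k+1}$ via $x\mapsto I_n\otimes x$ and $A_{2k+1}\subset A_{2k+2}$ is induced by $\Delta_n\subset M_n$. This is a tower of Jones basic constructions with Jones projections $e_{2k+1}=\sum_i E_{ii}\otimes E_{ii}\otimes I_n^{\otimes k}\in A_{2k+1}$ ($k\ge0$) and $e_{2k}=J_n\otimes I_n^{\otimes k}\in A_{2k}$ ($k\ge 1$). $R$ is the hyperfinite $II_1$ factor obtained as the SOT-closure of $\bigcup_k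 A_k$ in the GNS representation of the normalized trace. The spin model subfactor $R_u\subset R$ is the von Neumann subalgebra generated by $u\Delta_nu^*\subset A_0$ and all $e_j$, $j\ge1$. The same $R$ and $e_j$ are used for $u$ and $v$. The condition $\beta\notin\{\alpha,\alpha\pm\pi\}$ is equivalent to $v\ne uPD$ for every permutation matrix $P$ and diagonal unitary $D$ (written $u\nsim v$), and to $R_u\ne R_v$. Pimsner-Popa constant. For von Neumann subalgebras $\mathcal P,\mathcal Q$ of a finite von Neumann algebra $\mathcal M$ with fixed faithful normal trace and trace-preserving conditional expectation $E^{\mathcal M}_{\mathcal Q}$, $\lambda(\mathcal P,\mathcal Q)=\sup\{t\ge0: E^{\mathcal M}_{\mathcal Q}(x)\ge tx\ \ \forall x\in\mathcal P_+\}$. *)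

theory Defs
  imports "HOL-Analysis.Analysis"
begin

section \<open>Complex Hilbert spaces and von Neumann algebras\<close>

text \<open>The complex inner product is linear in the first argument; its real part is the inner
  product of the underlying real Hilbert space, so that norm, topology and completeness are those
  of the library.\<close>

class complex_hilbert_space = real_inner + banach +
  fixes scaleC :: "complex \<Rightarrow> 'a \<Rightarrow> 'a"  (infixr \<open>*\<^sub>C\<close> 75)
    and cinner :: "'a \<Rightarrow> 'a \<Rightarrow> complex"
  assumes scaleC_add_right: "a *\<^sub>C (x + y) = a *\<^sub>C x + a *\<^sub>C y"
    and scaleC_add_left: "(a + b) *\<^sub>C x = a *\<^sub>C x + b *\<^sub>C x"
    and scaleC_scaleC: "a *\<^sub>C (b *\<^sub>C x) = (a * b) *\<^sub>C x"
    and scaleC_complex_of_real: "complex_of_real r *\<^sub>C x = r *\<^sub>R x"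
    and cinner_add_left: "cinner (x + y) z = cinner x z + cinner y z"
    and cinner_scaleC_left: "cinner (a *\<^sub>C x) y = a * cinner x y"
    and cinner_commute: "cinner y x = cnj (cinner x y)"
    and Re_cinner: "Re (cinner x y) = inner x y"

lemma norm_scaleC:
  fixes x :: "'h::complex_hilbert_space"
  shows "norm (c *\<^sub>C x) = cmod c * norm x"
proof -
  have "cinner (c *\<^sub>C x) (c *\<^sub>C x) = c * cnj c * cinner x x"
    by (metis cinner_commute cinner_scaleC_left complex_cnj_mult mult.assoc mult.commute)
  also have "\<dots> = complex_of_real ((cmod c)\<^sup>2) * cinner x x"
    by (metis complex_norm_square of_real_power)
  finally have "inner (c *\<^sub>C x) (c *\<^sub>C x) = (cmod c)\<^sup>2 * inner x x"
    by (simp flip: Re_cinner)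
  then have "(norm (c *\<^sub>C x))\<^sup>2 = (cmod c * norm x)\<^sup>2"
    by (simp add: power2_norm_eq_inner power_mult_distrib)
  then show ?thesis
    by (simp add: power2_eq_iff_nonneg)
qed

lemma bounded_linear_scaleC: "bounded_linear (\<lambda>x::'h::complex_hilbert_space. c *\<^sub>C x)"
proof (rule bounded_linear_intro[where K = "cmod c"])
  fix r :: real and x :: 'h
  show "c *\<^sub>C (r *\<^sub>R x) = r *\<^sub>R (c *\<^sub>C x)"
    by (metis mult.commute scaleC_complex_of_real scaleC_scaleC)
qed (simp_all add: scaleC_add_right norm_scaleC mult.commute)

text \<open>The library's bounded operators are only required to be real linear.\<close>

definition complex_linear_op :: "('h::complex_hilbert_space \<Rightarrow>\<^sub>L 'h) \<Rightarrow> bool" where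
  "complex_linear_op T \<longleftrightarrow> (\<forall>c x. T (c *\<^sub>C x) = c *\<^sub>C T x)"

definition scaleC_op :: "complex \<Rightarrow> ('h::complex_hilbert_space \<Rightarrow>\<^sub>L 'h) \<Rightarrow> ('h \<Rightarrow>\<^sub>L 'h)" where
  "scaleC_op c T = Blinfun (\<lambda>x. c *\<^sub>C T x)"

lemma scaleC_op_apply [simp]: "scaleC_op c T x = c *\<^sub>C T x"
  unfolding scaleC_op_def
  by (rule bounded_linear_Blinfun_apply[THEN fun_cong])
    (rule bounded_linear_compose[OF bounded_linear_scaleC blinfun.bounded_linear_right])

definition is_adjoint :: "('h::complex_hilbert_space \<Rightarrow>\<^sub>L 'h) \<Rightarrow> ('h \<Rightarrow>\<^sub>L 'h) \<Rightarrow> bool" where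
  "is_adjoint S T \<longleftrightarrow> (\<forall>x y. cinner (T x) y = cinner x (S y))"

definition positive_op :: "('h::complex_hilbert_space \<Rightarrow>\<^sub>L 'h) \<Rightarrow> bool" where
  "positive_op T \<longleftrightarrow> (\<forall>x. cinner (T x) x \<in> \<real>\<^sub>\<ge>\<^sub>0)"

definition von_neumann_algebra :: "('h::complex_hilbert_space \<Rightarrow>\<^sub>L 'h) set \<Rightarrow> bool" where
  "von_neumann_algebra M \<longleftrightarrow>
     (\<forall>T\<in>M. complex_linear_op T) \<and>
     id_blinfun \<in> M \<and>
     (\<forall>S\<in>M. \<forall>T\<in>M. S + T \<in> M) \<and>
     (\<forall>c. \<forall>T\<in>M. scaleC_op c T \<in> M) \<and>
     (\<forall>S\<in>M. \<forall>T\<in>M. S o\<^sub>L T \<in> M) \<and>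
     (\<forall>T\<in>M. \<exists>S\<in>M. is_adjoint S T) \<and>
     closedin strong_operator_topology M"

definition generated_von_neumann_algebra ::
    "('h::complex_hilbert_space \<Rightarrow>\<^sub>L 'h) set \<Rightarrow> ('h \<Rightarrow>\<^sub>L 'h) set" where
  "generated_von_neumann_algebra X = von_neumann_algebra hull X"


section \<open>The Pimsner-Popa constant\<close>

text \<open>Elements of the extensional function space are fixed to be undefined outside \<open>M\<close>,
  which makes the trace preserving conditional expectation of \<open>M\<close> onto \<open>Q\<close> unique as a function.\<close>

definition is_conditional_expectation ::
    "('h::complex_hilbert_space \<Rightarrow>\<^sub>L 'h) set \<Rightarrow> (('h \<Rightarrow>\<^sub>L 'h) \<Rightarrow> complex) \<Rightarrow> ('h \<Rightarrow>\<^sub>L 'h) set \<Rightarrow>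
      (('h \<Rightarrow>\<^sub>L 'h) \<Rightarrow> ('h \<Rightarrow>\<^sub>L 'h)) \<Rightarrow> bool" where
  "is_conditional_expectation M \<tau> Q E \<longleftrightarrow>
     E \<in> M \<rightarrow>\<^sub>E Q \<and>
     (\<forall>S\<in>M. \<forall>T\<in>M. E (S + T) = E S + E T) \<and>
     (\<forall>c. \<forall>T\<in>M. E (scaleC_op c T) = scaleC_op c (E T)) \<and>
     (\<forall>T\<in>M. positive_op T \<longrightarrow> positive_op (E T)) \<and>
     (\<forall>T\<in>Q. E T = T) \<and>
     (\<forall>A\<in>Q. \<forall>T\<in>M. \<forall>B\<in>Q. E (A o\<^sub>L T o\<^sub>L B) = A o\<^sub>L E T o\<^sub>L B) \<and>
     (\<forall>T\<in>M. \<tau> (E T) = \<tau> T)"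

definition conditional_expectation ::
    "('h::complex_hilbert_space \<Rightarrow>\<^sub>L 'h) set \<Rightarrow> (('h \<Rightarrow>\<^sub>L 'h) \<Rightarrow> complex) \<Rightarrow> ('h \<Rightarrow>\<^sub>L 'h) set \<Rightarrow>
      ('h \<Rightarrow>\<^sub>L 'h) \<Rightarrow> ('h \<Rightarrow>\<^sub>L 'h)" where
  "conditional_expectation M \<tau> Q = (THE E. is_conditional_expectation M \<tau> Q E)"

definition pimsner_popa_constant ::
    "('h::complex_hilbert_space \<Rightarrow>\<^sub>L 'h) set \<Rightarrow> (('h \<Rightarrow>\<^sub>L 'h) \<Rightarrow> complex) \<Rightarrow>
      ('h \<Rightarrow>\<^sub>L 'h) set \<Rightarrow> ('h \<Rightarrow>\<^sub>L 'h) set \<Rightarrow> real" where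
  "pimsner_popa_constant M \<tau> P Q =
     Sup {t. 0 \<le> t \<and> (\<forall>x\<in>P. positive_op x \<longrightarrow>
                positive_op (conditional_expectation M \<tau> Q x - t *\<^sub>R x))}"


section \<open>The tower of the spin model\<close>

text \<open>An element of the union of the tower is written as a matrix indexed by configurations
  \<open>s :: nat \<Rightarrow> 'n\<close>: position \<open>j\<close> of a configuration is the index of the \<open>j\<close>-th tensor leg, legs
  being counted from the right starting with 0. The inclusions \<open>x \<mapsto> I \<otimes> x\<close>, which put the new leg
  on the left, then become literal inclusions of sets of such matrices.\<close>

type_synonym 'n config_matrix = "(nat \<Rightarrow> 'n) \<Rightarrow> (nat \<Rightarrow> 'n) \<Rightarrow> complex"

text \<open>\<open>amplify m a\<close> is \<open>\<dots> \<otimes> I \<otimes> I \<otimes> a\<close> for a matrix \<open>a\<close> indexed by the multi-indices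
  of legs \<open>0, \<dots>, m - 1\<close>; thus \<open>tensor_power m\<close> is the \<open>m\<close>-th tensor power of the algebra of
  matrices over \<open>'n\<close>.\<close>

definition amplify :: "nat \<Rightarrow> 'n config_matrix \<Rightarrow> 'n config_matrix" where
  "amplify m a = (\<lambda>s t. if \<forall>j\<ge>m. s j = t j then a (restrict s {..<m}) (restrict t {..<m}) else 0)"

definition tensor_power :: "nat \<Rightarrow> 'n config_matrix set" where
  "tensor_power m = range (amplify m)"

text \<open>\<open>A\<^sub>2\<^sub>k\<close> has the full legs \<open>0, \<dots>, k\<close>; \<open>A\<^sub>2\<^sub>k\<^sub>+\<^sub>1\<close> has in addition the
  diagonal leg \<open>k + 1\<close>.\<close>

definition spin_tower :: "int \<Rightarrow> 'n config_matrix set" where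
  "spin_tower i =
     (if even i then tensor_power (nat (i div 2) + 1)
      else {x \<in> tensor_power (nat ((i + 1) div 2) + 1).
              \<forall>s t. s (nat ((i + 1) div 2)) \<noteq> t (nat ((i + 1) div 2)) \<longrightarrow> x s t = 0})"

definition spin_union :: "'n config_matrix set" where
  "spin_union = (\<Union>i\<in>{-1..}. spin_tower i)"

definition cm_one :: "'n config_matrix" where
  "cm_one = (\<lambda>s t. if s = t then 1 else 0)"

definition cm_add :: "'n config_matrix \<Rightarrow> 'n config_matrix \<Rightarrow> 'n config_matrix" where
  "cm_add x y = (\<lambda>s t. x s t + y s t)"

definition cm_scale :: "complex \<Rightarrow> 'n config_matrix \<Rightarrow> 'n config_matrix" where
  "cm_scale c x = (\<lambda>s t. c * x s t)"

text \<open>Rows of elements of \<^term>\<open>spin_union\<close> have finite support (for finite \<open>'n\<close>), so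
  the sum is finite.\<close>

definition cm_mult :: "'n config_matrix \<Rightarrow> 'n config_matrix \<Rightarrow> 'n config_matrix" where
  "cm_mult x y = (\<lambda>s t. \<Sum>r | x s r \<noteq> 0. x s r * y r t)"

definition cm_adjoint :: "'n config_matrix \<Rightarrow> 'n config_matrix" where
  "cm_adjoint x = (\<lambda>s t. cnj (x t s))"

text \<open>The normalized trace of an element of \<^term>\<open>tensor_power m\<close>; extensional configurations
  serve as the multi-indices of its legs.\<close>

definition normalized_trace :: "nat \<Rightarrow> ('n::finite) config_matrix \<Rightarrow> complex" where
  "normalized_trace m x = (\<Sum>s\<in>{..<m} \<rightarrow>\<^sub>E UNIV. x s s) / of_nat CARD('n) ^ m"

definition on_leg :: "nat \<Rightarrow> complex^'n^'n \<Rightarrow> 'n config_matrix" where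
  "on_leg j a = (\<lambda>s t. if \<forall>l. l \<noteq> j \<longrightarrow> s l = t l then a $ s j $ t j else 0)"

definition matrix_unit :: "'n \<Rightarrow> 'n \<Rightarrow> complex^'n^'n" where
  "matrix_unit i j = (\<chi> k l. if k = i \<and> l = j then 1 else 0)"

definition J_matrix :: "complex^'n^'n" where
  "J_matrix = (\<chi> k l. 1 / of_nat CARD('n))"

definition jones_projection :: "nat \<Rightarrow> ('n::finite) config_matrix" where
  "jones_projection j =
     (if even j then on_leg (j div 2) J_matrix
      else (\<lambda>s t. \<Sum>i\<in>UNIV. cm_mult (on_leg (j div 2 + 1) (matrix_unit i i))
                                   (on_leg (j div 2) (matrix_unit i i)) s t))"


section \<open>Spin model subfactors\<close>

text \<open>\<open>\<pi>\<close> and \<open>\<Omega>\<close> form a GNS representation of \<^term>\<open>spin_union\<close> for the normalized trace. It is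
  determined up to unitary equivalence.\<close>

definition gns_representation ::
    "(('n::finite) config_matrix \<Rightarrow> ('h::complex_hilbert_space \<Rightarrow>\<^sub>L 'h)) \<Rightarrow> 'h \<Rightarrow> bool" where
  "gns_representation \<pi> \<Omega> \<longleftrightarrow>
     (\<forall>x\<in>spin_union. complex_linear_op (\<pi> x)) \<and>
     \<pi> cm_one = id_blinfun \<and>
     (\<forall>x\<in>spin_union. \<forall>y\<in>spin_union. \<pi> (cm_add x y) = \<pi> x + \<pi> y) \<and>
     (\<forall>c. \<forall>x\<in>spin_union. \<pi> (cm_scale c x) = scaleC_op c (\<pi> x)) \<and>
     (\<forall>x\<in>spin_union. \<forall>y\<in>spin_union. \<pi> (cm_mult x y) = \<pi> x o\<^sub>L \<pi> y) \<and>
     (\<forall>x\<in>spin_union. is_adjoint (\<pi> (cm_adjoint x)) (\<pi> x)) \<and>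
     closure ((\<lambda>x. \<pi> x \<Omega>) ` spin_union) = UNIV \<and>
     (\<forall>m. \<forall>x\<in>tensor_power m. cinner (\<pi> x \<Omega>) \<Omega> = normalized_trace m x)"

definition spin_factor ::
    "(('n::finite) config_matrix \<Rightarrow> ('h::complex_hilbert_space \<Rightarrow>\<^sub>L 'h)) \<Rightarrow> ('h \<Rightarrow>\<^sub>L 'h) set" where
  "spin_factor \<pi> = strong_operator_topology closure_of (\<pi> ` spin_union)"

definition vector_trace :: "'h::complex_hilbert_space \<Rightarrow> ('h \<Rightarrow>\<^sub>L 'h) \<Rightarrow> complex" where
  "vector_trace \<Omega> T = cinner (T \<Omega>) \<Omega>"

definition conj_transpose :: "complex^'n^'n \<Rightarrow> complex^'n^'n" where
  "conj_transpose u = map_matrix cnj (transpose u)"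

definition diagonal_matrices :: "(complex^'n^'n) set" where
  "diagonal_matrices = {d. \<forall>i j. i \<noteq> j \<longrightarrow> d $ i $ j = 0}"

definition spin_subfactor ::
    "(('n::finite) config_matrix \<Rightarrow> ('h::complex_hilbert_space \<Rightarrow>\<^sub>L 'h)) \<Rightarrow> complex^'n^'n \<Rightarrow>
      ('h \<Rightarrow>\<^sub>L 'h) set" where
  "spin_subfactor \<pi> u = generated_von_neumann_algebra
     ({\<pi> (on_leg 0 (u ** d ** conj_transpose u)) | d. d \<in> diagonal_matrices} \<union>
      {\<pi> (jones_projection j) | j. 1 \<le> j})"

definition phase_hadamard :: "real \<Rightarrow> complex^2^2" where
  "phase_hadamard \<alpha> = (1 / sqrt 2) *\<^sub>R
     vector [vector [1, 1],
             vector [exp (\<i> * of_real \<alpha>), - exp (\<i> * of_real \<alpha>)]]"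

end

theory Submission
  imports Defs
begin

text \<open>Write \<open>X(\<gamma>)\<close> for the self-adjoint unitary \<open>2 \<times> 2\<close> matrix with zero diagonal, entry
  \<open>e\<^sup>-\<^sup>i\<^sup>\<gamma>\<close> above and \<open>e\<^sup>i\<^sup>\<gamma>\<close> below the diagonal, \<open>X = X(0)\<close> and \<open>Z = diag(1, -1)\<close>, and let an
  index of a matrix as in \<open>X\<^sub>k\<close> name the leg on which it acts. Since \<open>v Z v\<^sup>* = X(\<beta>)\<close>, and since the
  Jones projections are \<open>(1 + Z\<^sub>k\<^sub>+\<^sub>1 Z\<^sub>k) / 2\<close> for odd and \<open>(1 + X\<^sub>k) / 2\<close>, \<open>k \<ge> 1\<close>, for even index,
  \<open>R\<^sub>v\<close> is generated by \<open>X(\<beta>)\<close> on leg 0, all \<open>X\<^sub>k\<close> with \<open>k \<ge> 1\<close> and all \<open>Z\<^sub>k\<^sub>+\<^sub>1 Z\<^sub>k\<close>.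

  Conjugation by the infinite tensor product \<open>\<dots> \<otimes> X \<otimes> X \<otimes> X(\<beta>)\<close> is a trace preserving automorphism
  \<open>\<theta>\<^sub>\<beta>\<close> of period two of the union of the tower, called \<open>spin_flip\<close> below. It fixes the generators of
  \<open>R\<^sub>v\<close>, and conversely every fixed matrix of a finite tensor power is a combination of products of
  them (\<open>flip_fixed_generated\<close>). In the GNS representation \<open>\<theta>\<^sub>\<beta>\<close> is conjugation by a self-adjoint
  unitary \<open>U\<close> with \<open>U \<Omega> = \<Omega>\<close> (\<open>implements_flip_exists\<close>), so \<open>R\<^sub>v\<close> is the fixed-point algebra of
  \<open>T \<mapsto> U T U\<close> on \<open>R\<close> (\<open>spin_subfactor_eq_fixed_points\<close>) and the conditional expectation onto it is
  the average \<open>E(T) = (T + U T U) / 2\<close>.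

  The constant is at least \<open>1/2\<close> because \<open>E(T) - T/2 = U T U / 2\<close> is positive with \<open>T\<close>. For the other
  inequality take the projection \<open>p = (1 + X(\<alpha>)) / 2\<close> on leg 0, which lies in \<open>R\<^sub>u\<close>. As
  \<open>X(\<beta>) X(\<alpha>) X(\<beta>)\<close> is \<open>X(\<delta>)\<close> for \<open>\<delta> = 2\<beta> - \<alpha>\<close>, \<open>E(p) = (p + q) / 2\<close> with \<open>q = (1 + X(\<delta>)) / 2\<close>. The vector
  \<open>\<xi> = \<Omega> - X(\<delta>) \<Omega>\<close> is killed by \<open>q\<close>, hence \<open>\<langle>(E(p) - t p) \<xi>, \<xi>\<rangle> = (1/2 - t) \<parallel>p \<xi>\<parallel>\<^sup>2\<close>, and \<open>p \<xi> \<noteq> 0\<close>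
  because \<open>\<langle>p \<xi>, \<Omega>\<rangle> = (1 - cos (2(\<beta> - \<alpha>))) / 2 = sin\<^sup>2 (\<beta> - \<alpha>)\<close>. Positivity thus forces \<open>t \<le> 1/2\<close>.

  Two facts about \<open>R\<close> itself support this. The strong closure of a unital *-algebra is closed under
  adjoints although the adjoint is not strongly continuous (\<open>von_neumann_algebra_sot_closure\<close>), and
  \<open>\<Omega>\<close> is separating because the trace makes right multiplications bounded (\<open>gns_separating\<close>); the
  latter makes the trace preserving conditional expectation unique.\<close>

section \<open>The strong operator topology\<close>

lemma sot_closure_iff:
  fixes T :: "'a::real_normed_vector \<Rightarrow>\<^sub>L 'b::real_normed_vector"
  shows "T \<in> strong_operator_topology closure_of A \<longleftrightarrow>
    (\<forall>F e. finite F \<longrightarrow> e > 0 \<longrightarrow> (\<exists>S\<in>A. \<forall>x\<in>F. norm (S x - T x) < e))"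
    (is "?L \<longleftrightarrow> ?R")
proof
  assume T: ?L
  show ?R
  proof (intro allI impI)
    fix F :: "'a set" and e :: real
    assume "finite F" "e > 0"
    let ?N = "{S. \<forall>x\<in>F. blinfun_apply S x \<in> ball (T x) e}"
    have "openin strong_operator_topology ?N"
      by (rule strong_operator_topology_basis[OF \<open>finite F\<close>]) simp
    moreover have "T \<in> ?N" using \<open>e > 0\<close> by simp
    ultimately obtain S where "S \<in> A" "S \<in> ?N"
      using T unfolding in_closure_of by meson
    then show "\<exists>S\<in>A. \<forall>x\<in>F. norm (S x - T x) < e"
      by (auto simp: dist_norm norm_minus_commute)
  qed
next
  assume R: ?R
  show ?L
    unfolding in_closure_of strong_operator_topology_topspace
  proof (intro conjI UNIV_I allI impI)
    fix N
    assume N: "T \<in> N \<and> openin strong_operator_topology N"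
    then obtain V where V: "open V" "N = blinfun_apply -` V"
      unfolding strong_operator_topology_def openin_pullback_topology by auto
    then have "openin (product_topology (\<lambda>i. euclidean) UNIV) V"
      by (simp add: euclidean_product_topology)
    then obtain U where U: "finite {i. U i \<noteq> UNIV}" "\<And>i. open (U i)"
      "blinfun_apply T \<in> Pi\<^sub>E UNIV U" "Pi\<^sub>E UNIV U \<subseteq> V"
      using N V unfolding openin_product_topology_alt by fastforce
    let ?F = "{i. U i \<noteq> UNIV}"
    have "\<exists>e>0. ball (T i) e \<subseteq> U i" for i
      using U(2)[of i] U(3) open_contains_ball by (metis PiE_mem UNIV_I)
    then obtain r where r: "\<And>i. r i > 0" "\<And>i. ball (T i) (r i) \<subseteq> U i"
      by metis
    define e where "e = Min (insert 1 (r ` ?F))"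
    have e: "e > 0" "\<And>i. i \<in> ?F \<Longrightarrow> e \<le> r i"
      using U(1) r(1) by (auto simp: e_def)
    obtain S where S: "S \<in> A" "\<forall>x\<in>?F. norm (S x - T x) < e"
      using R U(1) e(1) by meson
    have "S i \<in> U i" for i
    proof (cases "i \<in> ?F")
      case True
      then have "S i \<in> ball (T i) (r i)"
        using S(2) e(2)[OF True] by (fastforce simp: dist_norm norm_minus_commute)
      then show ?thesis using r(2) by blast
    qed auto
    then have "blinfun_apply S \<in> V"
      using U(4) by (auto simp: PiE_def)
    then show "\<exists>y. y \<in> A \<and> y \<in> N" using S(1) V(2) by auto
  qed
qed

lemma sot_continuous_image:
  assumes "\<And>x. continuous_map strong_operator_topology euclidean (\<lambda>S. blinfun_apply (f S) x)"
    and "\<And>S. S \<in> A \<Longrightarrow> f S \<in> B"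
    and "T \<in> strong_operator_topology closure_of A"
  shows "f T \<in> strong_operator_topology closure_of B"
proof -
  have "continuous_map strong_operator_topology strong_operator_topology f"
    unfolding continuous_on_strong_operator_topo_iff_coordinatewise using assms(1) by blast
  from continuous_map_image_closure_subset[OF this, of A]
  have "f T \<in> strong_operator_topology closure_of (f ` A)" using assms(3) by blast
  moreover have "f ` A \<subseteq> B" using assms(2) by blast
  ultimately show ?thesis using closure_of_mono by blast
qed

lemma sot_continuous_eval_left:
  fixes A :: "'b::real_normed_vector \<Rightarrow>\<^sub>L 'c::real_normed_vector"
  shows "continuous_map strong_operator_topology euclidean (\<lambda>S. A (blinfun_apply S x))"
proof -
  have "continuous_map euclidean euclidean (blinfun_apply A)"
    by (simp add: blinfun.continuous_on)
  from continuous_map_compose[OF strong_operator_topology_continuous_evaluation[of x] this]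
  show ?thesis by (simp add: comp_def)
qed

text \<open>Complex linearity and invariance under a conjugation are both conditions of this form.\<close>

lemma sot_closedin_eq:
  fixes A B :: "'b::real_normed_vector \<Rightarrow>\<^sub>L 'c::real_normed_vector" and X :: "'a::real_normed_vector set"
  shows "closedin strong_operator_topology {S :: 'a \<Rightarrow>\<^sub>L 'b. \<forall>x\<in>X. A (S (f x)) = B (S (g x))}"
proof -
  have *: "closedin strong_operator_topology {S :: 'a \<Rightarrow>\<^sub>L 'b. A (S (f x)) = B (S (g x))}" for x
  proof -
    have "closedin strong_operator_topology
      {S \<in> topspace strong_operator_topology. A (blinfun_apply S (f x)) = B (S (g x))}"
      by (rule closedin_continuous_maps_eq[of euclidean])
         (auto intro: sot_continuous_eval_left)
    then show ?thesis by (simp add: strong_operator_topology_topspace)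
  qed
  have "{S :: 'a \<Rightarrow>\<^sub>L 'b. \<forall>x\<in>X. A (S (f x)) = B (S (g x))} =
     topspace strong_operator_topology \<inter> \<Inter> ((\<lambda>x. {S :: 'a \<Rightarrow>\<^sub>L 'b. A (S (f x)) = B (S (g x))}) ` X)"
    by (auto simp: strong_operator_topology_topspace)
  also have "closedin strong_operator_topology \<dots>"
    by (cases "X = {}") (auto intro!: closedin_Inter closedin_Int *)
  finally show ?thesis .
qed

section \<open>Orthogonality and adjoints in Hilbert spaces\<close>

text \<open>The projection argument in a finite power of a Hilbert space: a minimizing sequence in \<open>W\<close> is Cauchy
  in every coordinate by the parallelogram law, and the vector from its limit to \<open>a\<close> is orthogonal to
  \<open>W\<close>. Tuples are functions on a finite set of indices, so that their length is not tied to a type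
  and can be the number of vectors in a neighbourhood for the strong operator topology.\<close>

lemma orthogonal_separation:
  fixes W :: "('i \<Rightarrow> 'h::{real_inner,banach}) set" and a :: "'i \<Rightarrow> 'h"
  assumes "finite I" and zero: "(\<lambda>_. 0) \<in> W"
    and add: "\<And>v w. v \<in> W \<Longrightarrow> w \<in> W \<Longrightarrow> (\<lambda>i. v i + w i) \<in> W"
    and scale: "\<And>c w. w \<in> W \<Longrightarrow> (\<lambda>i. c *\<^sub>R w i) \<in> W"
    and "e\<^sub>0 > 0" and far: "\<And>w. w \<in> W \<Longrightarrow> \<exists>i\<in>I. norm (w i - a i) \<ge> e\<^sub>0"
  obtains \<eta> where "\<And>w. w \<in> W \<Longrightarrow> (\<Sum>i\<in>I. w i \<bullet> \<eta> i) = 0" "(\<Sum>i\<in>I. a i \<bullet> \<eta> i) \<noteq> 0"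
proof -
  define q where "q w = (\<Sum>i\<in>I. (norm (w i - a i))\<^sup>2)" for w
  define d where "d = Inf (q ` W)"
  have q_ge: "e\<^sub>0\<^sup>2 \<le> q w" if w: "w \<in> W" for w
  proof -
    obtain i where i: "i \<in> I" "norm (w i - a i) \<ge> e\<^sub>0" using far[OF w] by blast
    have "e\<^sub>0\<^sup>2 \<le> (norm (w i - a i))\<^sup>2" using i(2) \<open>e\<^sub>0 > 0\<close> by (intro power_mono) auto
    also have "\<dots> \<le> q w" unfolding q_def using i(1) \<open>finite I\<close> by (intro member_le_sum) auto
    finally show ?thesis .
  qed
  have bdd: "bdd_below (q ` W)" using q_ge by (intro bdd_belowI2)
  have d_le: "d \<le> q w" if "w \<in> W" for w
    unfolding d_def using bdd that by (intro cInf_lower) auto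
  have "e\<^sub>0\<^sup>2 \<le> d" unfolding d_def using zero q_ge by (intro cInf_greatest) auto
  then have "d > 0" using \<open>e\<^sub>0 > 0\<close> by (smt (verit) zero_less_power)
  have "\<exists>w\<in>W. q w < d + inverse (Suc k)" for k
  proof -
    have "Inf (q ` W) < d + inverse (Suc k)" by (simp add: d_def)
    then show ?thesis using zero bdd by (subst (asm) cInf_less_iff) auto
  qed
  then obtain w where wW: "\<And>k. w k \<in> W" and wq: "\<And>k. q (w k) < d + inverse (Suc k)"
    by metis
  have close: "(norm (w k i - w l i))\<^sup>2 \<le> 2 * inverse (Suc k) + 2 * inverse (Suc l)"
    if "i \<in> I" for i k l
  proof -
    have parallelogram: "(norm (x - y))\<^sup>2 = 2 * (norm (x - b))\<^sup>2 + 2 * (norm (y - b))\<^sup>2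
        - 4 * (norm ((1/2) *\<^sub>R (x + y) - b))\<^sup>2" for x y b :: 'h
      by (simp add: power2_norm_eq_inner inner_diff_left inner_diff_right inner_add_left
          inner_add_right inner_commute algebra_simps)
    let ?m = "\<lambda>i. (1/2) *\<^sub>R (w k i + w l i)"
    have "(norm (w k i - w l i))\<^sup>2 \<le> (\<Sum>i\<in>I. (norm (w k i - w l i))\<^sup>2)"
      using that \<open>finite I\<close> by (intro member_le_sum) auto
    also have "\<dots> = 2 * q (w k) + 2 * q (w l) - 4 * q ?m"
      unfolding q_def sum_distrib_left sum.distrib[symmetric] sum_subtractf[symmetric]
      by (intro sum.cong refl parallelogram)
    also have "\<dots> \<le> 2 * (d + inverse (Suc k)) + 2 * (d + inverse (Suc l)) - 4 * d"
      using wq[of k] wq[of l] d_le[of ?m] scale[OF add[OF wW wW]] by fastforce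
    finally show ?thesis by simp
  qed
  have "Cauchy (\<lambda>k. w k i)" if "i \<in> I" for i
  proof (rule CauchyI)
    fix e :: real assume "e > 0"
    then obtain N where N: "inverse (real (Suc N)) < e\<^sup>2 / 4"
      using reals_Archimedean[of "e\<^sup>2 / 4"] by auto
    show "\<exists>M. \<forall>m\<ge>M. \<forall>n\<ge>M. norm (w m i - w n i) < e"
    proof (intro exI allI impI)
      fix m n assume "N \<le> m" "N \<le> n"
      then have "inverse (real (Suc m)) \<le> inverse (real (Suc N))"
        "inverse (real (Suc n)) \<le> inverse (real (Suc N))"
        by (auto intro!: le_imp_inverse_le)
      then have "(norm (w m i - w n i))\<^sup>2 < e\<^sup>2" using close[OF that, of m n] N by linarith
      then show "norm (w m i - w n i) < e" using \<open>e > 0\<close> by (simp add: power_less_imp_less_base)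
    qed
  qed
  then have "\<forall>i. \<exists>z. i \<in> I \<longrightarrow> (\<lambda>k. w k i) \<longlonglongrightarrow> z"
    by (meson Cauchy_convergent convergent_def)
  then obtain \<zeta> where \<zeta>: "\<And>i. i \<in> I \<Longrightarrow> (\<lambda>k. w k i) \<longlonglongrightarrow> \<zeta> i" by metis
  define \<eta> where "\<eta> i = a i - \<zeta> i" for i
  have limq: "(\<lambda>k. q (\<lambda>i. w k i + t *\<^sub>R v i)) \<longlonglongrightarrow> q (\<lambda>i. \<zeta> i + t *\<^sub>R v i)" for t v
    unfolding q_def by (intro tendsto_intros \<zeta>)
  have "q \<zeta> \<le> d"
  proof (rule LIMSEQ_le)
    show "(\<lambda>k. q (w k)) \<longlonglongrightarrow> q \<zeta>" using limq[of 0] by simp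
    show "(\<lambda>k. d + inverse (Suc k)) \<longlonglongrightarrow> d"
      using tendsto_add[OF tendsto_const[of d] LIMSEQ_inverse_real_of_nat] by simp
  qed (use wq less_imp_le in blast)
  have q_min: "d \<le> q (\<lambda>i. \<zeta> i + t *\<^sub>R v i)" if "v \<in> W" for t v
    by (rule LIMSEQ_le_const[OF limq]) (use d_le[OF add[OF wW scale[OF that]]] in blast)
  have orth: "(\<Sum>i\<in>I. v i \<bullet> \<eta> i) = 0" if "v \<in> W" for v
  proof -
    define B where "B = (\<Sum>i\<in>I. v i \<bullet> \<eta> i)"
    define C where "C = (\<Sum>i\<in>I. v i \<bullet> v i)"
    have "C \<ge> 0" unfolding C_def by (intro sum_nonneg) auto
    have expand: "q (\<lambda>i. \<zeta> i + t *\<^sub>R v i) = q \<zeta> - 2 * t * B + t\<^sup>2 * C" for t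
    proof -
      have "(norm (\<zeta> i + t *\<^sub>R v i - a i))\<^sup>2 =
          (norm (\<zeta> i - a i))\<^sup>2 - 2 * t * (v i \<bullet> \<eta> i) + t\<^sup>2 * (v i \<bullet> v i)" for i
        unfolding power2_norm_eq_inner \<eta>_def
        by (simp add: inner_diff_left inner_diff_right inner_add_left inner_add_right
          inner_commute algebra_simps power2_eq_square)
      then show ?thesis
        by (simp add: q_def B_def C_def sum.distrib sum_subtractf sum_distrib_left)
    qed
    \<comment> \<open>The quadratic in \<open>t\<close> has its minimum at \<open>B / C\<close>; this nearby value also makes sense for \<open>C = 0\<close>.\<close>
    define t where "t = B / (C + 1)"
    have "2 * t * B \<le> t\<^sup>2 * C" using q_min[OF that, of t] \<open>q \<zeta> \<le> d\<close> expand[of t] by linarith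
    moreover have "B = t * (C + 1)" using \<open>C \<ge> 0\<close> by (simp add: t_def)
    ultimately have "t\<^sup>2 * (C + 2) \<le> 0" by (simp add: power2_eq_square algebra_simps)
    then have "t = 0" using \<open>C \<ge> 0\<close> by (smt (verit) mult_pos_pos zero_less_power2)
    then show ?thesis using \<open>B = t * (C + 1)\<close> by (simp add: B_def)
  qed
  have "(\<lambda>k. \<Sum>i\<in>I. w k i \<bullet> \<eta> i) \<longlonglongrightarrow> (\<Sum>i\<in>I. \<zeta> i \<bullet> \<eta> i)" by (intro tendsto_intros \<zeta>)
  then have "(\<Sum>i\<in>I. \<zeta> i \<bullet> \<eta> i) = 0" by (simp add: orth[OF wW] LIMSEQ_const_iff)
  moreover have "(\<Sum>i\<in>I. a i \<bullet> \<eta> i) = (\<Sum>i\<in>I. \<zeta> i \<bullet> \<eta> i) + q \<zeta>"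
    unfolding q_def sum.distrib[symmetric] power2_norm_eq_inner \<eta>_def
    by (intro sum.cong) (auto simp: inner_diff_left inner_diff_right inner_commute)
  moreover have "d \<le> q \<zeta>" using q_min[OF zero, of 0] by simp
  ultimately show thesis using that orth \<open>d > 0\<close> by fastforce
qed

text \<open>A vector with nonzero value under \<open>f\<close> has positive distance from the kernel of \<open>f\<close>, so some \<open>\<eta>\<close> is
  orthogonal to the kernel but not to that vector; a multiple of \<open>\<eta>\<close> represents \<open>f\<close>.\<close>

lemma riesz_representation:
  fixes f :: "'h::{real_inner,banach} \<Rightarrow> real"
  assumes "bounded_linear f"
  obtains y where "\<And>x. f x = x \<bullet> y"
proof (cases "\<forall>x. f x = 0")
  case True
  then show thesis using that[of 0] by simp
next
  case False
  interpret f: bounded_linear f by fact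
  obtain a where a: "f a \<noteq> 0" using False by blast
  obtain K where K: "K > 0" "\<And>x. norm (f x) \<le> norm x * K" using f.pos_bounded by blast
  let ?W = "{w :: unit \<Rightarrow> 'h. f (w ()) = 0}"
  have far: "\<exists>i\<in>UNIV. norm (w i - a) \<ge> \<bar>f a\<bar> / K" if "w \<in> ?W" for w :: "unit \<Rightarrow> 'h"
  proof -
    have "\<bar>f a\<bar> = norm (f (w () - a))" using that by (simp add: f.diff)
    then have "\<bar>f a\<bar> \<le> norm (w () - a) * K" using K(2) by metis
    then show ?thesis using K(1) by (auto simp: pos_divide_le_eq)
  qed
  obtain \<eta> where \<eta>: "\<And>w. w \<in> ?W \<Longrightarrow> (\<Sum>i\<in>UNIV. w i \<bullet> \<eta> i) = 0" "(\<Sum>i\<in>UNIV. a \<bullet> \<eta> i) \<noteq> 0"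
    by (rule orthogonal_separation[where W = ?W and I = UNIV and a = "\<lambda>_. a" and e\<^sub>0 = "\<bar>f a\<bar> / K"])
      (use a K far in \<open>auto simp: f.add f.scaleR\<close>)
  define y where "y = (f a / (a \<bullet> \<eta> ())) *\<^sub>R \<eta> ()"
  have "f x = x \<bullet> y" for x
  proof -
    have "(x - (f x / f a) *\<^sub>R a) \<bullet> \<eta> () = 0"
      using \<eta>(1)[of "\<lambda>_. x - (f x / f a) *\<^sub>R a"] a
      by (simp add: f.diff f.scaleR UNIV_unit)
    then have "x \<bullet> \<eta> () = (f x / f a) * (a \<bullet> \<eta> ())" by (simp add: inner_diff_left)
    then show ?thesis using a \<eta>(2) by (simp add: y_def UNIV_unit)
  qed
  then show thesis by (rule that)
qed

lemma cinner_scaleC_right: "cinner x (a *\<^sub>C y) = cnj a * cinner x (y::'h::complex_hilbert_space)"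
  by (metis cinner_commute cinner_scaleC_left complex_cnj_mult)

lemma cinner_scaleR_right: "cinner x (r *\<^sub>R y) = of_real r * cinner x (y::'h::complex_hilbert_space)"
  by (metis cinner_scaleC_right complex_cnj_complex_of_real scaleC_complex_of_real)

lemma cinner_add_right: "cinner x (y + z) = cinner x y + cinner x (z::'h::complex_hilbert_space)"
  by (metis cinner_commute cinner_add_left complex_cnj_add)

lemma cinner_scaleR_left: "cinner (r *\<^sub>R x) y = of_real r * cinner x (y::'h::complex_hilbert_space)"
  by (metis cinner_scaleC_left scaleC_complex_of_real)

lemma cinner_diff_left: "cinner (x - y) z = cinner x z - cinner y (z::'h::complex_hilbert_space)"
  by (metis add_diff_cancel_right' cinner_add_left diff_add_cancel)

lemma cinner_zero_left: "cinner 0 (x::'h::complex_hilbert_space) = 0"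
  using cinner_diff_left[of x x x] by simp

lemma Im_cinner: "Im (cinner x y) = ((- \<i>) *\<^sub>C x) \<bullet> (y::'h::complex_hilbert_space)"
  by (simp flip: Re_cinner add: cinner_scaleC_left)

lemma cinner_self: "cinner x x = of_real ((norm (x::'h::complex_hilbert_space))\<^sup>2)"
proof -
  have "Im (cinner x x) = 0" by (metis cinner_commute complex_cnj add.inverse_neutral
    complex.sel(2) complex_surj equation_minus_iff neg_equal_zero)
  then show ?thesis by (simp add: complex_eq_iff Re_cinner power2_norm_eq_inner)
qed

text \<open>Complex linearity recovers the imaginary part of the inner product from its real part, so that
  adjoints can be treated in the underlying real Hilbert space.\<close>

lemma is_adjoint_iff_inner:
  assumes "complex_linear_op T"
  shows "is_adjoint S T \<longleftrightarrow> (\<forall>x y. T x \<bullet> y = x \<bullet> S y)"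
proof
  assume "\<forall>x y. T x \<bullet> y = x \<bullet> S y"
  then show "is_adjoint S T"
    using assms unfolding is_adjoint_def complex_linear_op_def
    by (metis Im_cinner Re_cinner complex_eqI)
qed (metis is_adjoint_def Re_cinner)

lemma is_adjoint_sym: "is_adjoint S T \<Longrightarrow> is_adjoint T S"
  unfolding is_adjoint_def by (metis cinner_commute)

lemma is_adjoint_inner: "is_adjoint S T \<Longrightarrow> T x \<bullet> y = x \<bullet> S y"
  by (metis is_adjoint_def Re_cinner)

lemma is_adjoint_unique:
  assumes "is_adjoint S T" "is_adjoint S' T"
  shows "S = S'"
proof (rule blinfun_eqI)
  fix y
  show "S y = S' y"
    using is_adjoint_inner[OF assms(1)] is_adjoint_inner[OF assms(2)]
    by (intro vector_eq_ldot[THEN iffD1]) simp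
qed

lemma is_adjoint_compose: "is_adjoint S T \<Longrightarrow> is_adjoint S' T' \<Longrightarrow> is_adjoint (S' o\<^sub>L S) (T o\<^sub>L T')"
  by (simp add: is_adjoint_def)

lemma is_adjoint_complex_linear:
  assumes "is_adjoint S T"
  shows "complex_linear_op T"
  unfolding complex_linear_op_def
proof (intro allI)
  fix c x
  have "T (c *\<^sub>C x) \<bullet> y = (c *\<^sub>C T x) \<bullet> y" for y
    using assms unfolding is_adjoint_def by (metis Re_cinner cinner_scaleC_left)
  then show "T (c *\<^sub>C x) = c *\<^sub>C T x" by (intro vector_eq_rdot[THEN iffD1]) simp
qed

lemma ex_adjoint:
  assumes "complex_linear_op T"
  obtains S where "is_adjoint S T"
proof -
  have "\<forall>y. \<exists>z. \<forall>x. T x \<bullet> y = x \<bullet> z"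
  proof
    fix y
    have "bounded_linear (\<lambda>x. T x \<bullet> y)"
      by (intro bounded_linear_inner_left_comp blinfun.bounded_linear_right)
    then show "\<exists>z. \<forall>x. T x \<bullet> y = x \<bullet> z" by (rule riesz_representation) blast
  qed
  from choice[OF this] obtain s where "\<forall>y. \<forall>x. T x \<bullet> y = x \<bullet> s y" ..
  then have s: "T x \<bullet> y = x \<bullet> s y" for x y by simp
  have "bounded_linear s"
  proof (rule bounded_linear_intro[where K = "norm T"])
    show "s (x + y) = s x + s y" for x y
      by (rule vector_eq_ldot[THEN iffD1]) (simp add: inner_add_right flip: s)
    show "s (r *\<^sub>R x) = r *\<^sub>R s x" for r x
      by (rule vector_eq_ldot[THEN iffD1]) (simp flip: s)
    show "norm (s y) \<le> norm y * norm T" for y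
    proof -
      have "norm (s y) * norm (s y) = T (s y) \<bullet> y" by (simp add: s power2_norm_eq_inner flip: power2_eq_square)
      also have "\<dots> \<le> norm (T (s y)) * norm y" by (rule norm_cauchy_schwarz)
      also have "\<dots> \<le> norm (s y) * (norm y * norm T)"
        using mult_right_mono[OF norm_blinfun[of T "s y"] norm_ge_zero[of y]] by (simp only: mult_ac)
      finally show ?thesis by (cases "norm (s y) = 0") auto
    qed
  qed
  then have "is_adjoint (Blinfun s) T"
    by (simp add: is_adjoint_iff_inner[OF assms] bounded_linear_Blinfun_apply s)
  then show thesis by (rule that)
qed

text \<open>By polarization \<open>U\<close> preserves inner products, and it is its own inverse.\<close>

lemma isometric_involution_self_adjoint:
  assumes lin: "complex_linear_op U" and inv: "U o\<^sub>L U = id_blinfun" and iso: "\<And>x. norm (U x) = norm x"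
  shows "is_adjoint U U"
  unfolding is_adjoint_iff_inner[OF lin]
proof (intro allI)
  fix x y
  have UU: "U (U y) = y"
    using inv by (metis blinfun_apply_blinfun_compose blinfun_apply_id_blinfun id_apply)
  have "U x \<bullet> U z = x \<bullet> z" for z
    by (simp add: dot_norm iso flip: blinfun.add_right)
  from this[of "U y"] show "U x \<bullet> y = x \<bullet> U y" by (simp add: UU)
qed

text \<open>\<open>G\<close> is the graph of a densely defined isometry; no function need be chosen, since linearity and
  isometry make \<open>G\<close> single-valued. The closure of \<open>G\<close> has the same properties, and completeness makes
  its domain the whole space.\<close>

lemma isometry_extension:
  fixes G :: "('h::complex_hilbert_space \<times> 'h) set"
  assumes add: "\<And>x y x' y'. (x, y) \<in> G \<Longrightarrow> (x', y') \<in> G \<Longrightarrow> (x + x', y + y') \<in> G"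
    and scale: "\<And>c x y. (x, y) \<in> G \<Longrightarrow> (c *\<^sub>C x, c *\<^sub>C y) \<in> G"
    and isometric: "\<And>x y. (x, y) \<in> G \<Longrightarrow> norm y = norm x"
    and dense: "closure (fst ` G) = UNIV"
  obtains U where "complex_linear_op U" "\<And>x y. (x, y) \<in> G \<Longrightarrow> U x = y"
proof -
  let ?H = "closure G"
  have minus: "(x - x', y - y') \<in> G" if "(x, y) \<in> G" "(x', y') \<in> G" for x y x' y'
    using add[OF that(1) scale[OF that(2), of "-1"]]
    by (metis diff_conv_add_uminus of_real_1 of_real_minus scaleC_complex_of_real scaleR_minus1_left)
  have add': "(x + x', y + y') \<in> ?H" if xy: "(x, y) \<in> ?H" "(x', y') \<in> ?H" for x y x' y'
  proof -
    obtain f g where fg: "\<And>k. f k \<in> G" "f \<longlonglongrightarrow> (x, y)" "\<And>k. g k \<in> G" "g \<longlonglongrightarrow> (x', y')"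
      using xy unfolding closure_sequential by blast
    have "f k + g k \<in> G" for k using add fg(1,3)[of k] by (cases "f k"; cases "g k") auto
    moreover have "(\<lambda>k. f k + g k) \<longlonglongrightarrow> (x, y) + (x', y')" by (intro tendsto_add fg)
    ultimately show ?thesis
      unfolding closure_sequential by (intro exI[of _ "\<lambda>k. f k + g k"]) simp
  qed
  have scale': "(c *\<^sub>C x, c *\<^sub>C y) \<in> ?H" if xy: "(x, y) \<in> ?H" for x y c
  proof -
    obtain f where f: "\<And>k. f k \<in> G" "f \<longlonglongrightarrow> (x, y)" using xy unfolding closure_sequential by blast
    have "(c *\<^sub>C fst (f k), c *\<^sub>C snd (f k)) \<in> G" for k using scale f(1)[of k] by (cases "f k") auto
    moreover have "(\<lambda>k. (c *\<^sub>C fst (f k), c *\<^sub>C snd (f k))) \<longlonglongrightarrow> (c *\<^sub>C x, c *\<^sub>C y)"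
      using tendsto_fst[OF f(2)] tendsto_snd[OF f(2)]
      by (auto intro!: tendsto_Pair bounded_linear.tendsto[OF bounded_linear_scaleC])
    ultimately show ?thesis
      unfolding closure_sequential by (intro exI[of _ "\<lambda>k. (c *\<^sub>C fst (f k), c *\<^sub>C snd (f k))"]) simp
  qed
  have "?H \<subseteq> {p. norm (snd p) = norm (fst p)}"
  proof (rule closure_minimal)
    show "closed {p :: 'h \<times> 'h. norm (snd p) = norm (fst p)}"
      by (intro closed_Collect_eq continuous_intros)
  qed (use isometric in auto)
  then have isometric': "norm y = norm x" if "(x, y) \<in> ?H" for x y using that by auto
  have "\<exists>y. (x, y) \<in> ?H" for x
  proof -
    have "x \<in> closure (fst ` G)" by (simp add: dense)
    then obtain a where a: "\<And>k. a k \<in> fst ` G" "a \<longlonglongrightarrow> x" unfolding closure_sequential by blast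
    then have "\<forall>k. \<exists>b. (a k, b) \<in> G" by force
    then obtain b where b: "\<And>k. (a k, b k) \<in> G" by metis
    have "norm (b m - b n) = norm (a m - a n)" for m n by (rule isometric[OF minus[OF b b]])
    then have "Cauchy b" using LIMSEQ_imp_Cauchy[OF a(2)] by (simp add: Cauchy_iff)
    then obtain y where "b \<longlonglongrightarrow> y" using Cauchy_convergent convergent_def by blast
    then have "(\<lambda>k. (a k, b k)) \<longlonglongrightarrow> (x, y)" by (intro tendsto_Pair a)
    then have "(x, y) \<in> ?H"
      using b unfolding closure_sequential by (intro exI[of _ "\<lambda>k. (a k, b k)"]) simp
    then show ?thesis ..
  qed
  then obtain u where u: "\<And>x. (x, u x) \<in> ?H" by metis
  have unique: "u x = y" if "(x, y) \<in> ?H" for x y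
  proof -
    have "(x + (-1) *\<^sub>C x, u x + (-1) *\<^sub>C y) \<in> ?H" by (rule add'[OF u scale'[OF that]])
    moreover have "(-1) *\<^sub>C z = - z" for z :: 'h
      by (metis of_real_1 of_real_minus scaleC_complex_of_real scaleR_minus1_left)
    ultimately show ?thesis using isometric' by fastforce
  qed
  have "bounded_linear u"
  proof (rule bounded_linear_intro[where K = 1])
    show "u (x + y) = u x + u y" for x y by (rule unique[OF add'[OF u u]])
    show "u (r *\<^sub>R x) = r *\<^sub>R u x" for r x
      using unique[OF scale'[OF u]] by (metis scaleC_complex_of_real)
    show "norm (u x) \<le> norm x * 1" for x using isometric'[OF u] by simp
  qed
  then have U: "blinfun_apply (Blinfun u) = u" by (rule bounded_linear_Blinfun_apply)
  show thesis
  proof (rule that[of "Blinfun u"])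
    show "complex_linear_op (Blinfun u)"
      unfolding complex_linear_op_def U using unique[OF scale'[OF u]] by blast
    show "Blinfun u x = y" if "(x, y) \<in> G" for x y
      unfolding U using that closure_subset by (intro unique) blast
  qed
qed

lemma blinfun_eq_on_dense:
  assumes "closure D = UNIV" "\<And>x. x \<in> D \<Longrightarrow> blinfun_apply S x = blinfun_apply T x"
  shows "S = T"
proof (rule blinfun_eqI)
  fix x
  have "closure D \<subseteq> {x. blinfun_apply S x = blinfun_apply T x}"
    by (rule closure_minimal) (use assms in \<open>auto intro!: closed_Collect_eq continuous_intros\<close>)
  then show "blinfun_apply S x = blinfun_apply T x" using assms(1) by auto
qed

lemma positive_op_add: "positive_op S \<Longrightarrow> positive_op T \<Longrightarrow> positive_op (S + T)"
  by (simp add: positive_op_def blinfun.add_left cinner_add_left nonneg_Reals_add_I)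

lemma positive_op_scaleR: "0 \<le> r \<Longrightarrow> positive_op T \<Longrightarrow> positive_op (r *\<^sub>R T)"
  by (simp add: positive_op_def blinfun.scaleR_left cinner_scaleR_left nonneg_Reals_mult_I)

lemma positive_op_conjugate:
  assumes "is_adjoint V U" "positive_op T"
  shows "positive_op (V o\<^sub>L T o\<^sub>L U)"
  using assms is_adjoint_sym[OF assms(1)] by (simp add: positive_op_def is_adjoint_def)

section \<open>Von Neumann algebras\<close>

lemma scaleC_op_of_real: "scaleC_op (of_real r) T = r *\<^sub>R T"
  by (rule blinfun_eqI) (simp add: scaleC_complex_of_real blinfun.scaleR_left)

lemma von_neumann_algebraD:
  assumes "von_neumann_algebra M"
  shows "T \<in> M \<Longrightarrow> complex_linear_op T" "id_blinfun \<in> M"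
    "S \<in> M \<Longrightarrow> T \<in> M \<Longrightarrow> S + T \<in> M" "T \<in> M \<Longrightarrow> scaleC_op c T \<in> M"
    "S \<in> M \<Longrightarrow> T \<in> M \<Longrightarrow> S o\<^sub>L T \<in> M" "closedin strong_operator_topology M"
    "T \<in> M \<Longrightarrow> r *\<^sub>R T \<in> M" "S \<in> M \<Longrightarrow> T \<in> M \<Longrightarrow> S - T \<in> M"
proof -
  note M = assms[unfolded von_neumann_algebra_def]
  show "T \<in> M \<Longrightarrow> complex_linear_op T" "id_blinfun \<in> M"
    "S \<in> M \<Longrightarrow> T \<in> M \<Longrightarrow> S + T \<in> M" "T \<in> M \<Longrightarrow> scaleC_op c T \<in> M"
    "S \<in> M \<Longrightarrow> T \<in> M \<Longrightarrow> S o\<^sub>L T \<in> M" "closedin strong_operator_topology M"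
    using M by blast+
  have scaleR: "r *\<^sub>R T \<in> M" if "T \<in> M" for r T
    using M that by (metis scaleC_op_of_real)
  then show "T \<in> M \<Longrightarrow> r *\<^sub>R T \<in> M" .
  show "S - T \<in> M" if "S \<in> M" "T \<in> M"
  proof -
    have "S + (-1) *\<^sub>R T \<in> M" using M that scaleR by blast
    then show ?thesis by simp
  qed
qed

lemma von_neumann_algebra_adjoint:
  assumes "von_neumann_algebra M" "T \<in> M"
  obtains S where "S \<in> M" "is_adjoint S T"
  using assms unfolding von_neumann_algebra_def by blast

lemma complex_linear_op_sot_closed: "closedin strong_operator_topology
    (Collect (complex_linear_op :: ('h::complex_hilbert_space \<Rightarrow>\<^sub>L 'h) \<Rightarrow> bool))"
proof -
  have "Collect complex_linear_op =
    (\<Inter>c. {S :: 'h \<Rightarrow>\<^sub>L 'h. \<forall>x\<in>UNIV. id_blinfun (S (c *\<^sub>C x)) = scaleC_op c id_blinfun (S x)})"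
    by (auto simp: complex_linear_op_def)
  moreover have "closedin strong_operator_topology \<dots>"
    by (intro closedin_INT UNIV_not_empty sot_closedin_eq)
  ultimately show ?thesis by simp
qed

text \<open>Multiplication is strongly continuous only in each factor separately, so sums and products are
  closed up one argument at a time. The adjoint is not strongly continuous at all. If the adjoint \<open>S\<close>
  of some \<open>T\<close> in the closure were outside it, finitely many vectors \<open>x\<close> would witness this, and
  orthogonal separation would give \<open>\<eta>\<close> such that the functional \<open>R \<mapsto> \<Sum> \<langle>R x, \<eta> x\<rangle>\<close> vanishes on \<open>A\<close> but not at
  \<open>S\<close>. Moving operators to the other side, \<open>R \<mapsto> \<Sum> \<langle>x, R (\<eta> x)\<rangle>\<close> vanishes on \<open>A\<close> but not at
  \<open>T\<close>, contrary to its strong continuity.\<close>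

lemma von_neumann_algebra_sot_closure:
  assumes lin: "\<And>T. T \<in> A \<Longrightarrow> complex_linear_op T"
    and one: "id_blinfun \<in> A"
    and add: "\<And>S T. S \<in> A \<Longrightarrow> T \<in> A \<Longrightarrow> S + T \<in> A"
    and scale: "\<And>c T. T \<in> A \<Longrightarrow> scaleC_op c T \<in> A"
    and mult: "\<And>S T. S \<in> A \<Longrightarrow> T \<in> A \<Longrightarrow> S o\<^sub>L T \<in> A"
    and adj: "\<And>T. T \<in> A \<Longrightarrow> \<exists>S\<in>A. is_adjoint S T"
  shows "von_neumann_algebra (strong_operator_topology closure_of A)" (is "von_neumann_algebra ?M")
proof -
  note cont = strong_operator_topology_continuous_evaluation sot_continuous_eval_left
  have sub: "A \<subseteq> ?M"
    by (simp add: closure_of_subset strong_operator_topology_topspace)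
  have lin': "complex_linear_op T" if "T \<in> ?M" for T
    using closure_of_minimal[OF _ complex_linear_op_sot_closed, of A] lin that by blast
  have add': "S + T \<in> ?M" if "S \<in> ?M" "T \<in> ?M" for S T
  proof -
    have 1: "S' + T \<in> ?M" if "S' \<in> A" for S'
      by (rule sot_continuous_image[where f = "\<lambda>T. S' + T", OF _ _ \<open>T \<in> ?M\<close>])
        (auto simp: blinfun.add_left that add intro!: continuous_map_add cont)
    have "S + T \<in> strong_operator_topology closure_of ?M"
      by (rule sot_continuous_image[where f = "\<lambda>S. S + T", OF _ _ \<open>S \<in> ?M\<close>])
        (auto simp: blinfun.add_left 1 intro!: continuous_map_add cont)
    then show ?thesis by simp
  qed
  have scale': "scaleC_op c T \<in> ?M" if "T \<in> ?M" for c T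
    by (rule sot_continuous_image[OF _ _ that])
      (use sot_continuous_eval_left[of "scaleC_op c id_blinfun"] scale in simp_all)
  have mult': "S o\<^sub>L T \<in> ?M" if "S \<in> ?M" "T \<in> ?M" for S T
  proof -
    have 1: "S' o\<^sub>L T \<in> ?M" if "S' \<in> A" for S'
      by (rule sot_continuous_image[where f = "\<lambda>T. S' o\<^sub>L T", OF _ _ \<open>T \<in> ?M\<close>])
        (auto simp: that mult intro!: cont)
    have "S o\<^sub>L T \<in> strong_operator_topology closure_of ?M"
      by (rule sot_continuous_image[where f = "\<lambda>S. S o\<^sub>L T", OF _ _ \<open>S \<in> ?M\<close>])
        (auto simp: 1 intro!: cont)
    then show ?thesis by simp
  qed
  have adj': "\<exists>S\<in>?M. is_adjoint S T" if T: "T \<in> ?M" for T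
  proof -
    obtain S where S: "is_adjoint S T" by (rule ex_adjoint[OF lin'[OF T]])
    have "S \<in> ?M"
    proof (rule ccontr)
      assume "S \<notin> ?M"
      then obtain F e where F: "finite F" "e > 0" "\<And>R. R \<in> A \<Longrightarrow> \<exists>x\<in>F. norm (R x - S x) \<ge> e"
        unfolding sot_closure_iff by (meson not_less)
      obtain \<eta> where \<eta>: "\<And>w. w \<in> blinfun_apply ` A \<Longrightarrow> (\<Sum>x\<in>F. w x \<bullet> \<eta> x) = 0"
        "(\<Sum>x\<in>F. S x \<bullet> \<eta> x) \<noteq> 0"
      proof (rule orthogonal_separation[where I = F and a = "blinfun_apply S" and W = "blinfun_apply ` A"])
        have "scaleC_op 0 id_blinfun \<in> A" using scale one by blast
        moreover have "(\<lambda>_. 0) = blinfun_apply (scaleC_op 0 id_blinfun :: 'a \<Rightarrow>\<^sub>L 'a)"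
          by (rule ext) (metis of_real_0 scaleC_complex_of_real scaleC_op_apply scaleR_zero_left)
        ultimately show "(\<lambda>_. 0) \<in> blinfun_apply ` A" by blast
        show "(\<lambda>i. v i + w i) \<in> blinfun_apply ` A"
          if "v \<in> blinfun_apply ` A" "w \<in> blinfun_apply ` A" for v w
        proof -
          obtain V W where VW: "V \<in> A" "W \<in> A" "v = V" "w = W" using \<open>v \<in> _\<close> \<open>w \<in> _\<close> by blast
          have "(\<lambda>i. v i + w i) = blinfun_apply (V + W)" by (simp add: VW fun_eq_iff blinfun.add_left)
          then show ?thesis using add[OF VW(1,2)] by blast
        qed
        show "(\<lambda>i. c *\<^sub>R w i) \<in> blinfun_apply ` A" if w: "w \<in> blinfun_apply ` A" for c w
        proof -
          obtain W where W: "W \<in> A" "w = W" using w by blast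
          have "(\<lambda>i. c *\<^sub>R w i) = blinfun_apply (scaleC_op (of_real c) W)"
            by (simp add: W fun_eq_iff scaleC_complex_of_real)
          then show ?thesis using scale[OF W(1)] by blast
        qed
      qed (use F in auto)
      have "continuous_map strong_operator_topology euclidean (\<lambda>R. x \<bullet> blinfun_apply R (\<eta> x))" for x
      proof -
        have "continuous_map euclidean euclidean (\<lambda>z. x \<bullet> z)"
          by (simp add: continuous_on_inner)
        from continuous_map_compose[OF cont(1) this] show ?thesis by (simp add: comp_def)
      qed
      then have "continuous_map strong_operator_topology euclidean (\<lambda>R. \<Sum>x\<in>F. x \<bullet> blinfun_apply R (\<eta> x))"
        by (intro continuous_map_sum F)
      then have "closedin strong_operator_topology
          {R \<in> topspace strong_operator_topology. (\<Sum>x\<in>F. x \<bullet> blinfun_apply R (\<eta> x)) \<in> {0}}"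
        by (rule closedin_continuous_map_preimage) auto
      moreover have "(\<Sum>x\<in>F. x \<bullet> R (\<eta> x)) = 0" if R: "R \<in> A" for R
      proof -
        obtain R' where "R' \<in> A" "is_adjoint R' R" using adj[OF R] by blast
        then show ?thesis using \<eta>(1)[of R']
          by (simp add: is_adjoint_inner[OF is_adjoint_sym])
      qed
      ultimately have "?M \<subseteq> {R. (\<Sum>x\<in>F. x \<bullet> blinfun_apply R (\<eta> x)) = 0}"
        by (intro closure_of_minimal) (auto simp: strong_operator_topology_topspace)
      then have "(\<Sum>x\<in>F. x \<bullet> T (\<eta> x)) = 0" using T by blast
      then show False using \<eta>(2) by (simp add: is_adjoint_inner[OF is_adjoint_sym[OF S]])
    qed
    then show ?thesis using S by blast
  qed
  show ?thesis
    unfolding von_neumann_algebra_def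
    by (intro conjI ballI allI closedin_closure_of lin' add' scale' mult' adj' subsetD[OF sub one])
qed

lemma von_neumann_algebra_fixed_points:
  assumes M: "von_neumann_algebra M"
    and U: "is_adjoint U U" "U o\<^sub>L U = id_blinfun"
  shows "von_neumann_algebra {T \<in> M. U o\<^sub>L T o\<^sub>L U = T}" (is "von_neumann_algebra ?F")
proof -
  note MD = von_neumann_algebraD[OF M]
  have UU [simp]: "U (U x) = x" for x
    using U(2) by (metis blinfun_apply_blinfun_compose blinfun_apply_id_blinfun id_apply)
  have lin: "U (c *\<^sub>C x) = c *\<^sub>C U x" for c x
    using is_adjoint_complex_linear[OF U(1)] by (simp add: complex_linear_op_def)
  have fix_iff: "U o\<^sub>L T o\<^sub>L U = T \<longleftrightarrow> (\<forall>x. U (T x) = T (U x))" for T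
  proof
    assume "U o\<^sub>L T o\<^sub>L U = T"
    then have "U (T (U (U x))) = T (U x)" for x by (metis blinfun_apply_blinfun_compose)
    then show "\<forall>x. U (T x) = T (U x)" by simp
  qed (auto intro!: blinfun_eqI)
  have "closedin strong_operator_topology {T. \<forall>x\<in>UNIV. U (blinfun_apply T x) = id_blinfun (T (U x))}"
    by (rule sot_closedin_eq)
  then have "closedin strong_operator_topology (M \<inter> {T. U o\<^sub>L T o\<^sub>L U = T})"
    by (intro closedin_Int MD) (simp add: fix_iff)
  then have closed: "closedin strong_operator_topology ?F" by (simp add: Int_def)
  have adjoint: "\<exists>S\<in>?F. is_adjoint S T" if "T \<in> ?F" for T
  proof -
    have T: "T \<in> M" "U o\<^sub>L T o\<^sub>L U = T" using that by auto
    then obtain S where S: "S \<in> M" "is_adjoint S T" using von_neumann_algebra_adjoint[OF M] by blast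
    have "is_adjoint (U o\<^sub>L S o\<^sub>L U) (U o\<^sub>L T o\<^sub>L U)"
      using S(2) U(1) by (simp add: is_adjoint_def)
    then have "U o\<^sub>L S o\<^sub>L U = S" unfolding T(2) by (rule is_adjoint_unique[OF _ S(2)])
    then show ?thesis using S by blast
  qed
  show ?thesis
    unfolding von_neumann_algebra_def
    using closed adjoint MD(1-5)
    by (simp add: fix_iff blinfun.add_left blinfun.add_right lin)
qed

section \<open>Conditional expectations\<close>

text \<open>The bimodule property and invariance of the trace give \<open>\<tau>(S E(T)) = \<tau>(S T)\<close> for \<open>S\<close> in \<open>Q\<close>, which
  does not involve \<open>E\<close>. When \<open>S\<close> is the adjoint of the difference \<open>D\<close> of the two expectations at \<open>T\<close>,
  this says that \<open>D \<Omega>\<close> has norm zero.\<close>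

lemma conditional_expectation_unique:
  assumes M: "von_neumann_algebra M" and Q: "von_neumann_algebra Q" "Q \<subseteq> M"
    and separating: "\<And>T. T \<in> M \<Longrightarrow> T \<Omega> = 0 \<Longrightarrow> T = 0"
    and E: "is_conditional_expectation M (vector_trace \<Omega>) Q E"
    and F: "is_conditional_expectation M (vector_trace \<Omega>) Q F"
  shows "E = F"
proof
  fix T
  show "E T = F T"
  proof (cases "T \<in> M")
    case True
    have in_Q: "E T \<in> Q" "F T \<in> Q"
      using E F True unfolding is_conditional_expectation_def by auto
    define D where "D = E T - F T"
    have "D \<in> Q" unfolding D_def by (rule von_neumann_algebraD(8)[OF Q(1) in_Q])
    then obtain S where S: "S \<in> Q" "is_adjoint S D" by (rule von_neumann_algebra_adjoint[OF Q(1)])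
    have trace: "vector_trace \<Omega> (S o\<^sub>L G T) = vector_trace \<Omega> (S o\<^sub>L T)"
      if G: "is_conditional_expectation M (vector_trace \<Omega>) Q G" for G
    proof -
      have "G (S o\<^sub>L T o\<^sub>L id_blinfun) = S o\<^sub>L G T o\<^sub>L id_blinfun"
        using G S(1) True von_neumann_algebraD(2)[OF Q(1)]
        unfolding is_conditional_expectation_def by blast
      moreover have "vector_trace \<Omega> (G (S o\<^sub>L T o\<^sub>L id_blinfun)) = vector_trace \<Omega> (S o\<^sub>L T o\<^sub>L id_blinfun)"
        using G S(1) Q(2) True von_neumann_algebraD(2,5)[OF M]
        unfolding is_conditional_expectation_def by blast
      ultimately show ?thesis by (simp add: vector_trace_def)
    qed
    have "cinner (D \<Omega>) (D \<Omega>) = vector_trace \<Omega> (S o\<^sub>L D)"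
      using is_adjoint_sym[OF S(2)] by (simp add: vector_trace_def is_adjoint_def)
    also have "\<dots> = vector_trace \<Omega> (S o\<^sub>L E T) - vector_trace \<Omega> (S o\<^sub>L F T)"
      by (simp add: D_def vector_trace_def blinfun.diff_left blinfun.diff_right cinner_diff_left)
    finally have "D \<Omega> = 0" by (simp add: trace[OF E] trace[OF F] cinner_self)
    then have "D = 0" using \<open>D \<in> Q\<close> Q(2) by (intro separating) auto
    then show ?thesis by (simp add: D_def)
  next
    case False
    then show ?thesis using E F unfolding is_conditional_expectation_def
      by (metis PiE_arb)
  qed
qed

text \<open>Averaging over a group of two trace preserving automorphisms projects onto their common fixed
  points.\<close>

lemma involution_conditional_expectation:
  assumes M: "von_neumann_algebra M"
    and U: "is_adjoint U U" "U o\<^sub>L U = id_blinfun" "U \<Omega> = \<Omega>"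
    and inv: "\<And>T. T \<in> M \<Longrightarrow> U o\<^sub>L T o\<^sub>L U \<in> M"
  shows "is_conditional_expectation M (vector_trace \<Omega>) {T \<in> M. U o\<^sub>L T o\<^sub>L U = T}
    (\<lambda>T\<in>M. (1/2) *\<^sub>R (T + (U o\<^sub>L T o\<^sub>L U)))"
proof -
  have UU [simp]: "U (U x) = x" for x
    using U(2) by (metis blinfun_apply_blinfun_compose blinfun_apply_id_blinfun id_apply)
  note MD = von_neumann_algebraD[OF M]
  note blinfun_simps = blinfun.add_left blinfun.add_right blinfun.scaleR_left blinfun.scaleR_right
    blinfun.diff_left blinfun.diff_right
  have in_M: "(1/2) *\<^sub>R (T + (U o\<^sub>L T o\<^sub>L U)) \<in> M" if "T \<in> M" for T
    using that by (intro MD inv)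
  have fixed: "U o\<^sub>L (1/2) *\<^sub>R (T + (U o\<^sub>L T o\<^sub>L U)) o\<^sub>L U = (1/2) *\<^sub>R (T + (U o\<^sub>L T o\<^sub>L U))" for T
    by (rule blinfun_eqI) (simp add: blinfun_simps add.commute)
  have add: "(1/2) *\<^sub>R (S + T + (U o\<^sub>L (S + T) o\<^sub>L U)) =
      (1/2) *\<^sub>R (S + (U o\<^sub>L S o\<^sub>L U)) + (1/2) *\<^sub>R (T + (U o\<^sub>L T o\<^sub>L U))" for S T
    by (rule blinfun_eqI) (simp add: blinfun_simps algebra_simps)
  have scale: "(1/2) *\<^sub>R (scaleC_op c T + (U o\<^sub>L scaleC_op c T o\<^sub>L U)) =
      scaleC_op c ((1/2) *\<^sub>R (T + (U o\<^sub>L T o\<^sub>L U)))" for c T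
  proof (rule blinfun_eqI)
    fix x
    have comm: "r *\<^sub>R c *\<^sub>C y = c *\<^sub>C r *\<^sub>R y" for r and y :: 'a
      by (metis mult.commute scaleC_complex_of_real scaleC_scaleC)
    then show "blinfun_apply ((1/2) *\<^sub>R (scaleC_op c T + (U o\<^sub>L scaleC_op c T o\<^sub>L U))) x =
      blinfun_apply (scaleC_op c ((1/2) *\<^sub>R (T + (U o\<^sub>L T o\<^sub>L U)))) x"
      using is_adjoint_complex_linear[OF U(1)] by (simp add: blinfun_simps complex_linear_op_def scaleC_add_right scaleR_add_right comm)
  qed
  have pos: "positive_op ((1/2) *\<^sub>R (T + (U o\<^sub>L T o\<^sub>L U)))" if "positive_op T" for T
    by (intro positive_op_scaleR positive_op_add positive_op_conjugate U that) simp
  have idem: "(1/2) *\<^sub>R (T + (U o\<^sub>L T o\<^sub>L U)) = T" if "U o\<^sub>L T o\<^sub>L U = T" for T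
    by (rule blinfun_eqI) (simp add: that blinfun_simps flip: scaleR_2)
  have bimod: "(1/2) *\<^sub>R ((A o\<^sub>L T o\<^sub>L B) + (U o\<^sub>L (A o\<^sub>L T o\<^sub>L B) o\<^sub>L U)) =
      A o\<^sub>L (1/2) *\<^sub>R (T + (U o\<^sub>L T o\<^sub>L U)) o\<^sub>L B"
    if AB: "U o\<^sub>L A o\<^sub>L U = A" "U o\<^sub>L B o\<^sub>L U = B" for A B T
  proof (rule blinfun_eqI)
    fix x
    have "U (A y) = A (U y)" for y
      using arg_cong[OF AB(1), of "\<lambda>S. U (blinfun_apply S y)"] by simp
    moreover have "B (U y) = U (B y)" for y
      using arg_cong[OF AB(2), of "\<lambda>S. U (blinfun_apply S y)"] by simp
    ultimately show "blinfun_apply ((1/2) *\<^sub>R ((A o\<^sub>L T o\<^sub>L B) + (U o\<^sub>L (A o\<^sub>L T o\<^sub>L B) o\<^sub>L U))) x =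
      blinfun_apply (A o\<^sub>L (1/2) *\<^sub>R (T + (U o\<^sub>L T o\<^sub>L U)) o\<^sub>L B) x"
      by (simp add: blinfun_simps)
  qed
  have trace: "vector_trace \<Omega> ((1/2) *\<^sub>R (T + (U o\<^sub>L T o\<^sub>L U))) = vector_trace \<Omega> T" for T
  proof -
    have "cinner (U (T \<Omega>)) \<Omega> = cinner (T \<Omega>) \<Omega>" using U(1,3) by (simp add: is_adjoint_def)
    then show ?thesis
      by (simp add: vector_trace_def blinfun_simps U(3) cinner_scaleR_left cinner_add_left)
  qed
  show ?thesis
    unfolding is_conditional_expectation_def
  proof (intro conjI ballI allI impI)
    show "(\<lambda>T\<in>M. (1/2) *\<^sub>R (T + (U o\<^sub>L T o\<^sub>L U))) \<in> M \<rightarrow>\<^sub>E {T \<in> M. U o\<^sub>L T o\<^sub>L U = T}"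
      by (intro restrict_PiE_iff[THEN iffD2] ballI CollectI conjI in_M fixed)
  next
    fix A T B
    assume "A \<in> {T \<in> M. U o\<^sub>L T o\<^sub>L U = T}" "T \<in> M" "B \<in> {T \<in> M. U o\<^sub>L T o\<^sub>L U = T}"
    then have "A \<in> M" "B \<in> M" "A o\<^sub>L T o\<^sub>L B \<in> M" "U o\<^sub>L A o\<^sub>L U = A" "U o\<^sub>L B o\<^sub>L U = B"
      by (auto intro: MD)
    then show "(\<lambda>T\<in>M. (1/2) *\<^sub>R (T + (U o\<^sub>L T o\<^sub>L U))) (A o\<^sub>L T o\<^sub>L B) =
        A o\<^sub>L (\<lambda>T\<in>M. (1/2) *\<^sub>R (T + (U o\<^sub>L T o\<^sub>L U))) T o\<^sub>L B"
      using bimod \<open>T \<in> M\<close> by (simp only: restrict_apply if_True)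
  qed (use MD(3,4) add scale pos idem trace in \<open>simp_all del: scaleR_scaleR scaleR_half_double\<close>)
qed

section \<open>Algebras of configuration matrices\<close>

lemma restrict_eq_iff: "restrict s A = restrict t A \<longleftrightarrow> (\<forall>j\<in>A. s j = t j)"
  by (auto simp: restrict_def fun_eq_iff)

lemma tensor_power_iff:
  "x \<in> tensor_power m \<longleftrightarrow>
    (\<forall>s t. (\<exists>j\<ge>m. s j \<noteq> t j) \<longrightarrow> x s t = 0) \<and>
    (\<forall>s t. (\<forall>j\<ge>m. s j = t j) \<longrightarrow> x s t = x (restrict s {..<m}) (restrict t {..<m}))"
    (is "_ \<longleftrightarrow> ?R")
proof
  assume "x \<in> tensor_power m"
  then obtain a where "x = amplify m a" unfolding tensor_power_def by blast
  then show ?R by (auto simp: amplify_def)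
next
  assume ?R
  then have "x s t = amplify m x s t" for s t
    unfolding amplify_def by (cases "\<forall>j\<ge>m. s j = t j") meson+
  then have "x = amplify m x" by (intro ext)
  then show "x \<in> tensor_power m" unfolding tensor_power_def by blast
qed

lemma tensor_power_zero: "x \<in> tensor_power m \<Longrightarrow> j \<ge> m \<Longrightarrow> s j \<noteq> t j \<Longrightarrow> x s t = 0"
  unfolding tensor_power_iff by blast

lemma tensor_power_restrict:
  "x \<in> tensor_power m \<Longrightarrow> (\<And>j. j \<ge> m \<Longrightarrow> s j = t j) \<Longrightarrow>
    x s t = x (restrict s {..<m}) (restrict t {..<m})"
  unfolding tensor_power_iff by blast

lemma tensor_power_local:
  assumes "x \<in> tensor_power m" "\<And>j. j \<ge> m \<Longrightarrow> s j = t j" "\<And>j. j \<ge> m \<Longrightarrow> s' j = t' j"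
    and "\<And>j. j < m \<Longrightarrow> s j = s' j" "\<And>j. j < m \<Longrightarrow> t j = t' j"
  shows "x s t = x s' t'"
proof -
  have "restrict s {..<m} = restrict s' {..<m}" "restrict t {..<m} = restrict t' {..<m}"
    using assms(4,5) by (auto simp: restrict_eq_iff)
  then show ?thesis
    using tensor_power_restrict[OF assms(1,2)] tensor_power_restrict[OF assms(1,3)] by simp
qed

lemma tensor_powerI:
  assumes "\<And>s t j. j \<ge> m \<Longrightarrow> s j \<noteq> t j \<Longrightarrow> x s t = 0"
    and "\<And>s t s' t'. (\<And>j. j \<ge> m \<Longrightarrow> s j = t j) \<Longrightarrow> (\<And>j. j \<ge> m \<Longrightarrow> s' j = t' j) \<Longrightarrow>
      (\<And>j. j < m \<Longrightarrow> s j = s' j) \<Longrightarrow> (\<And>j. j < m \<Longrightarrow> t j = t' j) \<Longrightarrow> x s t = x s' t'"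
  shows "x \<in> tensor_power m"
  unfolding tensor_power_iff by (intro conjI allI impI assms(2)) (use assms(1) in auto)

lemma tensor_power_mono:
  assumes "m \<le> m'"
  shows "tensor_power m \<subseteq> tensor_power m'"
proof
  fix x :: "'a config_matrix" assume x: "x \<in> tensor_power m"
  show "x \<in> tensor_power m'"
  proof (rule tensor_powerI)
    fix s t s' t' :: "nat \<Rightarrow> 'a"
    assume st: "\<And>j. j \<ge> m' \<Longrightarrow> s j = t j" "\<And>j. j \<ge> m' \<Longrightarrow> s' j = t' j"
      "\<And>j. j < m' \<Longrightarrow> s j = s' j" "\<And>j. j < m' \<Longrightarrow> t j = t' j"
    show "x s t = x s' t'"
    proof (cases "\<forall>j\<ge>m. s j = t j")
      case True
      then have "\<forall>j\<ge>m. s' j = t' j" using st by (metis not_less)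
      then show ?thesis using True st assms by (intro tensor_power_local[OF x]) auto
    next
      case False
      then obtain j where j: "j \<ge> m" "s j \<noteq> t j" by blast
      then have "s' j \<noteq> t' j" using st by (metis not_less)
      then show ?thesis using j tensor_power_zero[OF x] by metis
    qed
  next
    fix s t :: "nat \<Rightarrow> 'a" and j assume "j \<ge> m'" "s j \<noteq> t j"
    then show "x s t = 0" using assms by (intro tensor_power_zero[OF x, of j]) auto
  qed
qed

text \<open>An algebra with a diagonal leg is contained in the tensor power where this leg is full, so the even
  members of the tower exhaust the union.\<close>

lemma spin_union_eq: "(spin_union :: 'a config_matrix set) = (\<Union>m. tensor_power m)"
proof
  show "(spin_union :: 'a config_matrix set) \<subseteq> (\<Union>m. tensor_power m)"
    by (auto simp: spin_union_def spin_tower_def split: if_splits)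
  have "x \<in> spin_union" if "x \<in> tensor_power m" for m and x :: "'a config_matrix"
  proof -
    have "x \<in> tensor_power (Suc m)" using tensor_power_mono[of m "Suc m"] that by auto
    then have "x \<in> spin_tower (2 * int m)" by (simp add: spin_tower_def)
    then show ?thesis unfolding spin_union_def by fastforce
  qed
  then show "(\<Union>m. tensor_power m) \<subseteq> (spin_union :: 'a config_matrix set)" by blast
qed

lemma tensor_power_in_spin_union: "x \<in> tensor_power m \<Longrightarrow> x \<in> spin_union"
  unfolding spin_union_eq by blast

lemma spin_unionE:
  assumes "x \<in> spin_union" "y \<in> spin_union"
  obtains m where "m \<ge> 1" "x \<in> tensor_power m" "y \<in> tensor_power m"
proof -
  obtain k l where "x \<in> tensor_power k" "y \<in> tensor_power l"
    using assms unfolding spin_union_eq by blast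
  then show thesis
    using that[of "Suc (k + l)"] tensor_power_mono[of k "Suc (k + l)"] tensor_power_mono[of l "Suc (k + l)"]
    by auto
qed

lemma cm_one_tensor_power: "(cm_one :: 'a config_matrix) \<in> tensor_power m"
proof (rule tensor_powerI)
  fix s t s' t' :: "nat \<Rightarrow> 'a"
  assume "\<And>j. j \<ge> m \<Longrightarrow> s j = t j" "\<And>j. j \<ge> m \<Longrightarrow> s' j = t' j"
    "\<And>j. j < m \<Longrightarrow> s j = s' j" "\<And>j. j < m \<Longrightarrow> t j = t' j"
  then have "s j = t j \<longleftrightarrow> s' j = t' j" for j by (cases "j < m") auto
  then show "cm_one s t = (cm_one s' t' :: complex)" by (simp add: cm_one_def fun_eq_iff)
qed (auto simp: cm_one_def)

lemma cm_add_tensor_power: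
  assumes "x \<in> tensor_power m" "y \<in> tensor_power m"
  shows "cm_add x y \<in> tensor_power m"
proof -
  obtain a b where "x = amplify m a" "y = amplify m b"
    using assms unfolding tensor_power_def by blast
  then have "cm_add x y = amplify m (cm_add a b)"
    by (intro ext) (auto simp: amplify_def cm_add_def)
  then show ?thesis unfolding tensor_power_def by blast
qed

lemma cm_scale_tensor_power:
  assumes "x \<in> tensor_power m"
  shows "cm_scale c x \<in> tensor_power m"
proof -
  obtain a where "x = amplify m a" using assms unfolding tensor_power_def by blast
  then have "cm_scale c x = amplify m (cm_scale c a)"
    by (intro ext) (auto simp: amplify_def cm_scale_def)
  then show ?thesis unfolding tensor_power_def by blast
qed

lemma cm_adjoint_tensor_power:
  assumes "x \<in> tensor_power m"
  shows "cm_adjoint x \<in> tensor_power m"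
proof -
  obtain a where "x = amplify m a" using assms unfolding tensor_power_def by blast
  then have "cm_adjoint x = amplify m (cm_adjoint a)"
    by (intro ext) (auto simp: amplify_def cm_adjoint_def)
  then show ?thesis unfolding tensor_power_def by blast
qed

lemma cm_adjoint_adjoint [simp]: "cm_adjoint (cm_adjoint x) = x"
  by (simp add: cm_adjoint_def)

lemma on_leg_tensor_power:
  fixes a :: "complex^'n^'n"
  assumes "i < m"
  shows "on_leg i a \<in> tensor_power m"
proof (rule tensor_powerI)
  fix s t s' t' :: "nat \<Rightarrow> 'n"
  assume st: "\<And>j. j \<ge> m \<Longrightarrow> s j = t j" "\<And>j. j \<ge> m \<Longrightarrow> s' j = t' j"
    "\<And>j. j < m \<Longrightarrow> s j = s' j" "\<And>j. j < m \<Longrightarrow> t j = t' j"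
  then have "s j = t j \<longleftrightarrow> s' j = t' j" for j by (cases "j < m") auto
  then show "on_leg i a s t = on_leg i a s' t'" using st(3,4)[OF assms] by (auto simp: on_leg_def)
next
  fix s t :: "nat \<Rightarrow> 'n" and j assume "j \<ge> m" "s j \<noteq> t j"
  then have "\<not> (\<forall>l. l \<noteq> i \<longrightarrow> s l = t l)" using assms by (metis leD)
  then show "on_leg i a s t = 0" unfolding on_leg_def by (rule if_not_P)
qed

lemma bij_betw_restrict_tail:
  "bij_betw (\<lambda>r. restrict r {..<m}) {r :: nat \<Rightarrow> 'n. \<forall>j\<ge>m. r j = s j} ({..<m} \<rightarrow>\<^sub>E UNIV)"
proof (rule bij_betwI[where g = "\<lambda>r j. if j < m then r j else s j"])
  show "(\<lambda>j. if j < m then restrict x {..<m} j else s j) = x" if "x \<in> {r. \<forall>j\<ge>m. r j = s j}" for x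
    using that by (auto simp: fun_eq_iff)
  show "restrict (\<lambda>j. if j < m then y j else s j) {..<m} = y" if "y \<in> {..<m} \<rightarrow>\<^sub>E UNIV" for y
    using that by (auto simp: fun_eq_iff restrict_def PiE_def extensional_def)
qed auto

lemma finite_agreeing_tail: "finite {r :: nat \<Rightarrow> 'n::finite. \<forall>j\<ge>m. r j = s j}"
  using bij_betw_finite[OF bij_betw_restrict_tail[of m s]] finite_PiE[of "{..<m}" "\<lambda>_. UNIV :: 'n set"]
  by simp

text \<open>The sum defining a product ranges over a support that depends on the left factor; on a tensor power
  it can be replaced by the multi-indices of the first \<open>m\<close> legs, as in a product of finite matrices.\<close>

lemma cm_mult_tensor_power_eq:
  fixes x y :: "('n::finite) config_matrix"
  assumes x: "x \<in> tensor_power m" and y: "y \<in> tensor_power m" and st: "\<And>j. j \<ge> m \<Longrightarrow> s j = t j"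
  shows "cm_mult x y s t =
    (\<Sum>r\<in>{..<m} \<rightarrow>\<^sub>E UNIV. x (restrict s {..<m}) r * y r (restrict t {..<m}))"
proof -
  let ?R = "{r. \<forall>j\<ge>m. r j = s j}"
  have "cm_mult x y s t = (\<Sum>r\<in>?R. x s r * y r t)"
    unfolding cm_mult_def
  proof (rule sum.mono_neutral_left[OF finite_agreeing_tail])
    show "{r. x s r \<noteq> 0} \<subseteq> ?R"
    proof clarify
      fix r j assume "x s r \<noteq> 0" "m \<le> j"
      then show "r j = s j" using tensor_power_zero[OF x, of j s r] by metis
    qed
  qed auto
  also have "\<dots> = (\<Sum>r\<in>?R. x (restrict s {..<m}) (restrict r {..<m}) * y (restrict r {..<m}) (restrict t {..<m}))"
  proof (rule sum.cong[OF refl])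
    fix r assume r: "r \<in> ?R"
    show "x s r * y r t = x (restrict s {..<m}) (restrict r {..<m}) * y (restrict r {..<m}) (restrict t {..<m})"
      using r st tensor_power_restrict[OF x, of s r] tensor_power_restrict[OF y, of r t] by auto
  qed
  also have "\<dots> = (\<Sum>r\<in>{..<m} \<rightarrow>\<^sub>E UNIV. x (restrict s {..<m}) r * y r (restrict t {..<m}))"
    by (rule sum.reindex_bij_betw[OF bij_betw_restrict_tail])
  finally show ?thesis .
qed

lemma cm_mult_tensor_power:
  fixes x y :: "('n::finite) config_matrix"
  assumes x: "x \<in> tensor_power m" and y: "y \<in> tensor_power m"
  shows "cm_mult x y \<in> tensor_power m"
proof (rule tensor_powerI)
  fix s t :: "nat \<Rightarrow> 'n" and j assume j: "j \<ge> m" "s j \<noteq> t j"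
  have "x s r * y r t = 0" for r
    using tensor_power_zero[OF x j(1), of s r] tensor_power_zero[OF y j(1), of r t] j(2) by fastforce
  then show "cm_mult x y s t = 0" unfolding cm_mult_def by (intro sum.neutral) blast
next
  fix s t s' t' :: "nat \<Rightarrow> 'n"
  assume st: "\<And>j. j \<ge> m \<Longrightarrow> s j = t j" "\<And>j. j \<ge> m \<Longrightarrow> s' j = t' j"
    "\<And>j. j < m \<Longrightarrow> s j = s' j" "\<And>j. j < m \<Longrightarrow> t j = t' j"
  have "restrict s {..<m} = restrict s' {..<m}" "restrict t {..<m} = restrict t' {..<m}"
    using st(3,4) by (auto simp: restrict_eq_iff)
  then show "cm_mult x y s t = cm_mult x y s' t'"
    by (simp add: cm_mult_tensor_power_eq[OF x y] st(1,2))
qed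

lemma normalized_trace_commute:
  fixes x y :: "('n::finite) config_matrix"
  assumes "x \<in> tensor_power m" "y \<in> tensor_power m"
  shows "normalized_trace m (cm_mult x y) = normalized_trace m (cm_mult y x)"
proof -
  let ?I = "{..<m} \<rightarrow>\<^sub>E (UNIV :: 'n set)"
  have *: "(\<Sum>s\<in>?I. cm_mult a b s s) = (\<Sum>s\<in>?I. \<Sum>r\<in>?I. a s r * b r s)"
    if "a \<in> tensor_power m" "b \<in> tensor_power m" for a b
    by (rule sum.cong) (auto simp: cm_mult_tensor_power_eq[OF that] PiE_restrict)
  have "(\<Sum>s\<in>?I. \<Sum>r\<in>?I. x s r * y r s) = (\<Sum>s\<in>?I. \<Sum>r\<in>?I. y s r * x r s)"
    by (subst sum.swap) (simp add: mult.commute)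
  then show ?thesis unfolding normalized_trace_def *[OF assms] *[OF assms(2,1)] by simp
qed

lemma spin_union_closed:
  fixes x y :: "('n::finite) config_matrix"
  assumes "x \<in> spin_union"
  shows "cm_scale c x \<in> spin_union" "cm_adjoint x \<in> spin_union"
    and "y \<in> spin_union \<Longrightarrow> cm_add x y \<in> spin_union"
    and "y \<in> spin_union \<Longrightarrow> cm_mult x y \<in> spin_union"
proof -
  obtain m where m: "x \<in> tensor_power m" using assms unfolding spin_union_eq by blast
  show "cm_scale c x \<in> spin_union" "cm_adjoint x \<in> spin_union"
    by (rule tensor_power_in_spin_union[OF cm_scale_tensor_power[OF m]]
        tensor_power_in_spin_union[OF cm_adjoint_tensor_power[OF m]])+
  assume "y \<in> spin_union"
  with assms obtain k where k: "x \<in> tensor_power k" "y \<in> tensor_power k" by (rule spin_unionE)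
  show "cm_add x y \<in> spin_union" "cm_mult x y \<in> spin_union"
    by (rule tensor_power_in_spin_union[OF cm_add_tensor_power[OF k]]
        tensor_power_in_spin_union[OF cm_mult_tensor_power[OF k]])+
qed

lemma on_leg_in_spin_union: "on_leg j a \<in> spin_union"
  by (rule tensor_power_in_spin_union[OF on_leg_tensor_power[of j "Suc j"]]) simp

section \<open>Monomial configuration matrices\<close>

lemma two_cases: "(a :: 2) = 0 \<or> a = 1"
  using exhaust_2[of a] by auto

lemma add_self_two [simp]: "(a :: 2) + a = 0"
  using two_cases[of a] by auto

lemma add_self_two' [simp]: "(a :: 2) + (a + b) = b" "(a :: 2) + b + b = a"
  by (simp_all add: add.assoc flip: add.assoc[of a a b])

text \<open>Addition in the type \<open>2\<close> is modulo two, so \<open>S\<close> marks the legs on which \<open>s\<close> is flipped.\<close>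

definition shift :: "(nat \<Rightarrow> 2) \<Rightarrow> (nat \<Rightarrow> 2) \<Rightarrow> (nat \<Rightarrow> 2)" where
  "shift S s = (\<lambda>j. s j + S j)"

lemma shift_shift: "shift S (shift T s) = shift (shift S T) s"
  by (simp add: shift_def add_ac)

lemma shift_self [simp]: "shift S (shift S s) = s"
  by (simp add: shift_def add.assoc)

lemma shift_zero [simp]: "shift (\<lambda>_. 0) s = s"
  by (simp add: shift_def)

abbreviation single :: "nat \<Rightarrow> nat \<Rightarrow> 2" where
  "single j \<equiv> (\<lambda>_. 0)(j := 1)"

text \<open>The diagonal matrix of \<open>f\<close> times the product of the \<open>X\<^sub>j\<close> over the legs \<open>j\<close> with \<open>S j = 1\<close>. These
  matrices multiply like elements of a crossed product, and every matrix of a tensor power is a finite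
  sum of them, one for each set of flipped legs.\<close>

definition monomial :: "((nat \<Rightarrow> 2) \<Rightarrow> complex) \<Rightarrow> (nat \<Rightarrow> 2) \<Rightarrow> 2 config_matrix" where
  "monomial f S = (\<lambda>s t. if t = shift S s then f s else 0)"

lemma cm_mult_monomial:
  "cm_mult (monomial f S) (monomial g T) = monomial (\<lambda>s. f s * g (shift S s)) (shift T S)"
proof (intro ext)
  fix s t
  have "cm_mult (monomial f S) (monomial g T) s t =
      (\<Sum>r\<in>{shift S s}. monomial f S s r * monomial g T r t)"
    unfolding cm_mult_def by (rule sum.mono_neutral_left) (auto simp: monomial_def)
  also have "\<dots> = monomial (\<lambda>s. f s * g (shift S s)) (shift T S) s t"
    by (simp add: monomial_def shift_shift)
  finally show "cm_mult (monomial f S) (monomial g T) s t = \<dots>" .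
qed

lemma cm_add_monomial: "cm_add (monomial f S) (monomial g S) = monomial (\<lambda>s. f s + g s) S"
  by (auto simp: cm_add_def monomial_def fun_eq_iff)

lemma cm_scale_monomial: "cm_scale c (monomial f S) = monomial (\<lambda>s. c * f s) S"
  by (auto simp: cm_scale_def monomial_def fun_eq_iff)

lemma cm_one_monomial: "cm_one = monomial (\<lambda>_. 1) (\<lambda>_. 0)"
  by (auto simp: cm_one_def monomial_def fun_eq_iff)

lemma on_leg_diagonal: "on_leg j (matrix_unit i i) = monomial (\<lambda>s. of_bool (s j = i)) (\<lambda>_. 0)"
  by (auto simp: on_leg_def monomial_def matrix_unit_def fun_eq_iff shift_def)

lemma eq_shift_single_iff: "t = shift (single j) s \<longleftrightarrow> (\<forall>l. l \<noteq> j \<longrightarrow> s l = t l) \<and> t j = s j + 1"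
  by (auto simp: shift_def fun_eq_iff)

lemma on_leg_eq_monomials:
  "on_leg j a = cm_add (monomial (\<lambda>s. a $ s j $ s j) (\<lambda>_. 0))
                       (monomial (\<lambda>s. a $ s j $ (s j + 1)) (single j))"
proof (intro ext)
  fix s t :: "nat \<Rightarrow> 2"
  define P where "P \<longleftrightarrow> (\<forall>l. l \<noteq> j \<longrightarrow> s l = t l)"
  have "t j = s j \<or> t j = s j + 1" using two_cases[of "t j"] two_cases[of "s j"] by auto
  moreover have "t = s \<longleftrightarrow> P \<and> t j = s j" unfolding P_def fun_eq_iff by metis
  ultimately show "on_leg j a s t = cm_add (monomial (\<lambda>s. a $ s j $ s j) (\<lambda>_. 0))
                       (monomial (\<lambda>s. a $ s j $ (s j + 1)) (single j)) s t"
    unfolding on_leg_def cm_add_def monomial_def eq_shift_single_iff shift_zero P_def[symmetric]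
    by auto
qed

lemma jones_projection_odd:
  "jones_projection (2 * k + 1) = monomial (\<lambda>s. of_bool (s (Suc k) = s k)) (\<lambda>_. 0)"
proof (intro ext)
  fix s t :: "nat \<Rightarrow> 2"
  have "jones_projection (2 * k + 1) s t =
      (\<Sum>i\<in>UNIV. monomial (\<lambda>s. of_bool (s (Suc k) = i) * of_bool (s k = i)) (\<lambda>_. 0) s t)"
    by (simp add: jones_projection_def on_leg_diagonal cm_mult_monomial)
  also have "\<dots> = (if t = s then \<Sum>i\<in>UNIV. of_bool (s (Suc k) = i) * of_bool (s k = i) else 0)"
    by (simp add: monomial_def)
  also have "(\<Sum>i\<in>UNIV. of_bool (s (Suc k) = i) * of_bool (s k = i)) = (of_bool (s (Suc k) = s k) :: complex)"
    using two_cases[of "s k"] two_cases[of "s (Suc k)"] by (auto simp: sum_2)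
  finally show "jones_projection (2 * k + 1) s t =
      monomial (\<lambda>s. of_bool (s (Suc k) = s k)) (\<lambda>_. 0) s t"
    by (simp add: monomial_def)
qed

lemma jones_projection_in_spin_union: "jones_projection j \<in> (spin_union :: 2 config_matrix set)"
proof (cases "even j")
  case True
  then show ?thesis by (simp add: jones_projection_def on_leg_in_spin_union)
next
  case False
  then obtain k where j: "j = 2 * k + 1" by (auto elim: oddE)
  have "(\<lambda>s t. \<Sum>i\<in>UNIV. cm_mult (on_leg (k + 1) (matrix_unit i i)) (on_leg k (matrix_unit i i)) s t) =
     cm_add (cm_mult (on_leg (k + 1) (matrix_unit 1 1)) (on_leg k (matrix_unit 1 1)))
      (cm_mult (on_leg (k + 1) (matrix_unit 2 2)) (on_leg k (matrix_unit (2::2) 2)))"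
    by (simp add: sum_2 cm_add_def)
  then have "jones_projection j =
     cm_add (cm_mult (on_leg (k + 1) (matrix_unit 1 1)) (on_leg k (matrix_unit 1 1)))
      (cm_mult (on_leg (k + 1) (matrix_unit 2 2)) (on_leg k (matrix_unit (2::2) 2)))"
    by (simp add: jones_projection_def j)
  then show ?thesis by (simp add: spin_union_closed on_leg_in_spin_union)
qed

section \<open>The flip symmetry\<close>

text \<open>The nonzero entry in row \<open>s\<close> of \<open>\<dots> \<otimes> X \<otimes> X \<otimes> X(\<beta>)\<close>: the factors \<open>X\<close> contribute 1 and leg 0 contributes
  an entry of \<open>X(\<beta>)\<close>.\<close>

definition flip_phase :: "real \<Rightarrow> (nat \<Rightarrow> 2) \<Rightarrow> complex" where
  "flip_phase \<beta> s = (if s 0 = 1 then cis (- \<beta>) else cis \<beta>)"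

abbreviation flip :: "(nat \<Rightarrow> 2) \<Rightarrow> (nat \<Rightarrow> 2)" where
  "flip \<equiv> shift (\<lambda>_. 1)"

text \<open>Conjugation by \<open>\<dots> \<otimes> X \<otimes> X \<otimes> X(\<beta>)\<close>. This infinite product is not in the tower, but it has exactly one
  nonzero entry in each row and column, so that conjugating with it makes sense entrywise.\<close>

definition spin_flip :: "real \<Rightarrow> 2 config_matrix \<Rightarrow> 2 config_matrix" where
  "spin_flip \<beta> x = (\<lambda>s t. flip_phase \<beta> s * x (flip s) (flip t) * cnj (flip_phase \<beta> t))"

lemma flip_phase_unit [simp]: "flip_phase \<beta> s * cnj (flip_phase \<beta> s) = 1"
  by (simp add: flip_phase_def cis_cnj cis_mult)

lemma flip_phase_unit' [simp]: "cnj (flip_phase \<beta> s) * flip_phase \<beta> s = 1"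
  by (simp add: flip_phase_def cis_cnj cis_mult)

lemma flip_phase_sandwich [simp]: "flip_phase \<beta> s * x * cnj (flip_phase \<beta> s) = x"
  using flip_phase_unit[of \<beta> s] by (metis mult.assoc mult.commute mult_1)

lemma flip_phase_shift: "flip_phase \<beta> (shift S s) = (if S 0 = 0 then flip_phase \<beta> s else cnj (flip_phase \<beta> s))"
  using two_cases[of "s 0"] two_cases[of "S 0"] by (auto simp: flip_phase_def shift_def cis_cnj)

lemma spin_flip_flip [simp]: "spin_flip \<beta> (spin_flip \<beta> x) = x"
  by (intro ext) (simp add: spin_flip_def flip_phase_shift mult.assoc)

lemma spin_flip_mult: "spin_flip \<beta> (cm_mult x y) = cm_mult (spin_flip \<beta> x) (spin_flip \<beta> y)"
proof (intro ext)
  fix s t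
  have nz: "flip_phase \<beta> r \<noteq> 0" for r by (simp add: flip_phase_def)
  have "cm_mult (spin_flip \<beta> x) (spin_flip \<beta> y) s t =
     (\<Sum>r | x (flip s) (flip r) \<noteq> 0. spin_flip \<beta> x s r * spin_flip \<beta> y r t)"
    unfolding cm_mult_def by (rule sum.cong) (auto simp: spin_flip_def nz)
  also have "\<dots> = (\<Sum>r | x (flip s) (flip r) \<noteq> 0.
      flip_phase \<beta> s * (x (flip s) (flip r) * y (flip r) (flip t)) * cnj (flip_phase \<beta> t))"
  proof (rule sum.cong[OF refl])
    fix r
    have "spin_flip \<beta> x s r * spin_flip \<beta> y r t = (cnj (flip_phase \<beta> r) * flip_phase \<beta> r) *
      (flip_phase \<beta> s * (x (flip s) (flip r) * y (flip r) (flip t)) * cnj (flip_phase \<beta> t))"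
      by (simp add: spin_flip_def mult_ac del: flip_phase_unit flip_phase_unit')
    then show "spin_flip \<beta> x s r * spin_flip \<beta> y r t =
      flip_phase \<beta> s * (x (flip s) (flip r) * y (flip r) (flip t)) * cnj (flip_phase \<beta> t)" by simp
  qed
  also have "\<dots> = (\<Sum>r | x (flip s) r \<noteq> 0.
      flip_phase \<beta> s * (x (flip s) r * y r (flip t)) * cnj (flip_phase \<beta> t))"
    by (rule sum.reindex_bij_witness[of _ flip flip]) auto
  also have "\<dots> = spin_flip \<beta> (cm_mult x y) s t"
    by (simp add: spin_flip_def cm_mult_def sum_distrib_left sum_distrib_right)
  finally show "spin_flip \<beta> (cm_mult x y) s t = cm_mult (spin_flip \<beta> x) (spin_flip \<beta> y) s t" by simp
qed

lemma spin_flip_add: "spin_flip \<beta> (cm_add x y) = cm_add (spin_flip \<beta> x) (spin_flip \<beta> y)"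
  by (simp add: spin_flip_def cm_add_def algebra_simps)

lemma spin_flip_scale: "spin_flip \<beta> (cm_scale c x) = cm_scale c (spin_flip \<beta> x)"
  by (simp add: spin_flip_def cm_scale_def algebra_simps)

lemma spin_flip_adjoint: "spin_flip \<beta> (cm_adjoint x) = cm_adjoint (spin_flip \<beta> x)"
  by (simp add: spin_flip_def cm_adjoint_def mult_ac)

lemma spin_flip_monomial:
  "spin_flip \<beta> (monomial f S) =
    monomial (\<lambda>s. flip_phase \<beta> s * f (flip s) * cnj (flip_phase \<beta> (shift S s))) S"
proof -
  have "flip t = shift S (flip s) \<longleftrightarrow> t = shift S s" for s t
    by (simp add: shift_def fun_eq_iff add_ac)
  then show ?thesis by (intro ext) (simp add: spin_flip_def monomial_def)
qed

lemma spin_flip_one [simp]: "spin_flip \<beta> cm_one = cm_one"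
  by (simp add: cm_one_monomial spin_flip_monomial)

text \<open>At least one leg is needed because the phase depends on leg 0.\<close>

lemma spin_flip_tensor_power:
  assumes x: "x \<in> tensor_power m" and "m \<ge> 1"
  shows "spin_flip \<beta> x \<in> tensor_power m"
proof (rule tensor_powerI)
  fix s t :: "nat \<Rightarrow> 2" and j assume "j \<ge> m" "s j \<noteq> t j"
  then show "spin_flip \<beta> x s t = 0"
    using tensor_power_zero[OF x, of j "flip s" "flip t"] by (simp add: spin_flip_def shift_def)
next
  fix s t s' t' :: "nat \<Rightarrow> 2"
  assume st: "\<And>j. j \<ge> m \<Longrightarrow> s j = t j" "\<And>j. j \<ge> m \<Longrightarrow> s' j = t' j"
    "\<And>j. j < m \<Longrightarrow> s j = s' j" "\<And>j. j < m \<Longrightarrow> t j = t' j"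
  have "x (flip s) (flip t) = x (flip s') (flip t')"
    by (rule tensor_power_local[OF x]) (auto simp: shift_def st)
  moreover have "s 0 = s' 0" "t 0 = t' 0" using st(3,4)[of 0] \<open>m \<ge> 1\<close> by auto
  ultimately show "spin_flip \<beta> x s t = spin_flip \<beta> x s' t'"
    by (simp add: spin_flip_def flip_phase_def)
qed

lemma spin_flip_in_spin_union: "x \<in> spin_union \<Longrightarrow> spin_flip \<beta> x \<in> spin_union"
  by (metis spin_unionE spin_flip_tensor_power tensor_power_in_spin_union)

lemma normalized_trace_spin_flip:
  assumes x: "x \<in> tensor_power m"
  shows "normalized_trace m (spin_flip \<beta> x) = normalized_trace m x"
proof -
  have "(\<Sum>s\<in>{..<m} \<rightarrow>\<^sub>E UNIV. spin_flip \<beta> x s s) =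
      (\<Sum>s\<in>{..<m} \<rightarrow>\<^sub>E UNIV. x (restrict (flip s) {..<m}) (restrict (flip s) {..<m}))"
  proof (rule sum.cong[OF refl])
    fix s :: "nat \<Rightarrow> 2"
    have "spin_flip \<beta> x s s = (flip_phase \<beta> s * cnj (flip_phase \<beta> s)) * x (flip s) (flip s)"
      by (simp add: spin_flip_def mult_ac del: flip_phase_unit flip_phase_unit')
    then show "spin_flip \<beta> x s s = x (restrict (flip s) {..<m}) (restrict (flip s) {..<m})"
      using tensor_power_restrict[OF x, of "flip s" "flip s"] by simp
  qed
  also have "\<dots> = (\<Sum>s\<in>{..<m} \<rightarrow>\<^sub>E UNIV. x s s)"
  proof (rule sum.reindex_bij_witness[of _ "\<lambda>s. restrict (flip s) {..<m}" "\<lambda>s. restrict (flip s) {..<m}"])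
    show "restrict (flip (restrict (flip a) {..<m})) {..<m} = a" if "a \<in> {..<m} \<rightarrow>\<^sub>E UNIV" for a
      using that by (auto simp: fun_eq_iff shift_def restrict_def PiE_def extensional_def add.assoc)
    then show "restrict (flip (restrict (flip a) {..<m})) {..<m} = a" if "a \<in> {..<m} \<rightarrow>\<^sub>E UNIV" for a
      using that .
  qed auto
  finally show ?thesis by (simp add: normalized_trace_def)
qed

lemma spin_flip_jones_projection:
  assumes "j \<ge> 1"
  shows "spin_flip \<beta> (jones_projection j) = jones_projection j"
proof (cases "even j")
  case False
  then obtain k where "j = 2 * k + 1" by (auto elim: oddE)
  then show ?thesis
    by (simp only: jones_projection_odd spin_flip_monomial) (simp add: shift_def)
next
  case True
  then obtain k where k: "j = 2 * k" "k \<ge> 1" using assms by (auto elim!: evenE)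
  have "jones_projection j =
      cm_add (monomial (\<lambda>_. 1/2) (\<lambda>_. 0)) (monomial (\<lambda>_. 1/2) (single k))"
    by (simp add: k jones_projection_def on_leg_eq_monomials J_matrix_def)
  then show ?thesis using k(2)
    by (simp add: spin_flip_add spin_flip_monomial flip_phase_shift)
qed

section \<open>Hadamard reflections\<close>

text \<open>The matrix \<open>X(\<gamma>)\<close> on leg 0.\<close>

abbreviation hadamard_reflection :: "real \<Rightarrow> 2 config_matrix" where
  "hadamard_reflection \<gamma> \<equiv> monomial (flip_phase \<gamma>) (single 0)"

lemma spin_flip_hadamard_reflection:
  "spin_flip \<beta> (hadamard_reflection \<alpha>) = hadamard_reflection (2 * \<beta> - \<alpha>)"
proof -
  have "flip_phase \<beta> s * flip_phase \<alpha> (flip s) * cnj (flip_phase \<beta> (shift (single 0) s)) =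
      flip_phase (2 * \<beta> - \<alpha>) s" for s
    unfolding flip_phase_shift by (simp add: flip_phase_def cis_cnj cis_mult)
  then show ?thesis by (simp add: spin_flip_monomial)
qed

lemma hadamard_reflection_mult:
  "cm_mult (hadamard_reflection \<alpha>) (hadamard_reflection \<gamma>) =
    monomial (\<lambda>s. if s 0 = 1 then cis (\<gamma> - \<alpha>) else cis (\<alpha> - \<gamma>)) (\<lambda>_. 0)"
proof -
  have "flip_phase \<alpha> s * flip_phase \<gamma> (shift (single 0) s) =
      (if s 0 = 1 then cis (\<gamma> - \<alpha>) else cis (\<alpha> - \<gamma>))" for s
    unfolding flip_phase_shift by (simp add: flip_phase_def cis_cnj cis_mult)
  moreover have "shift (single 0) (single 0) = (\<lambda>_. 0)" by (simp add: shift_def fun_eq_iff)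
  ultimately show ?thesis by (simp only: cm_mult_monomial)
qed

lemma hadamard_reflection_adjoint: "cm_adjoint (hadamard_reflection \<gamma>) = hadamard_reflection \<gamma>"
proof (intro ext)
  fix s t
  have "s = shift (single 0) t \<longleftrightarrow> t = shift (single 0) s" by (metis shift_self)
  moreover have "cnj (flip_phase \<gamma> (shift (single 0) s)) = flip_phase \<gamma> s"
    unfolding flip_phase_shift by simp
  ultimately show "cm_adjoint (hadamard_reflection \<gamma>) s t = hadamard_reflection \<gamma> s t"
    unfolding cm_adjoint_def monomial_def by auto
qed

text \<open>Conjugation by the Hadamard matrix maps \<open>Z\<close> to \<open>X(\<beta>)\<close>, so it carries the diagonal algebra to the span of
  1 and \<open>X(\<beta>)\<close>.\<close>

lemma on_leg_hadamard_conj: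
  assumes "d \<in> diagonal_matrices"
  shows "on_leg 0 (phase_hadamard \<beta> ** d ** conj_transpose (phase_hadamard \<beta>)) =
    cm_add (cm_scale ((d $ 1 $ 1 + d $ 2 $ 2) / 2) cm_one)
      (cm_scale ((d $ 1 $ 1 - d $ 2 $ 2) / 2) (hadamard_reflection \<beta>))"
proof -
  let ?a = "phase_hadamard \<beta> ** d ** conj_transpose (phase_hadamard \<beta>)"
  have d: "d $ 1 $ 2 = 0" "d $ 2 $ 1 = 0" using assms by (auto simp: diagonal_matrices_def)
  have s: "complex_of_real (sqrt 2) * complex_of_real (sqrt 2) = 2"
    by (simp flip: of_real_mult)
  have h: "phase_hadamard \<beta> $ 1 $ 1 = 1 / of_real (sqrt 2)" "phase_hadamard \<beta> $ 1 $ 2 = 1 / of_real (sqrt 2)"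
    "phase_hadamard \<beta> $ 2 $ 1 = cis \<beta> / of_real (sqrt 2)" "phase_hadamard \<beta> $ 2 $ 2 = - cis \<beta> / of_real (sqrt 2)"
    unfolding phase_hadamard_def vector_scaleR_component vector_2 cis_conv_exp
    by (simp_all add: scaleR_conv_of_real)
  have c: "cis \<beta> * (cis (- \<beta>) * z) = z" for z
    by (simp add: cis_mult flip: mult.assoc)
  have a: "?a $ 1 $ 1 = (d $ 1 $ 1 + d $ 2 $ 2) / 2" "?a $ 2 $ 2 = (d $ 1 $ 1 + d $ 2 $ 2) / 2"
    "?a $ 1 $ 2 = (d $ 1 $ 1 - d $ 2 $ 2) / 2 * cis (- \<beta>)"
    "?a $ 2 $ 1 = (d $ 1 $ 1 - d $ 2 $ 2) / 2 * cis \<beta>"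
    by (simp_all add: matrix_matrix_mult_def conj_transpose_def map_matrix_def transpose_def sum_2 h d s c
        cis_cnj field_simps)
  have diag: "?a $ s 0 $ s 0 = (d $ 1 $ 1 + d $ 2 $ 2) / 2" for s :: "nat \<Rightarrow> 2"
    using exhaust_2[of "s 0"] a by auto
  have off: "?a $ s 0 $ (s 0 + 1) = (d $ 1 $ 1 - d $ 2 $ 2) / 2 * flip_phase \<beta> s" for s
  proof (cases "s 0 = 1")
    case True
    then have "s 0 + 1 = 2" by simp
    then show ?thesis unfolding \<open>s 0 + 1 = 2\<close> unfolding True a(3) by (simp add: flip_phase_def True)
  next
    case False
    then have "s 0 = 2" "s 0 + 1 = 1" using exhaust_2[of "s 0"] by auto
    then show ?thesis unfolding \<open>s 0 + 1 = 1\<close> unfolding \<open>s 0 = 2\<close> a(4)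
      using False by (simp add: flip_phase_def)
  qed
  show ?thesis
    unfolding on_leg_eq_monomials diag off cm_one_monomial cm_scale_monomial by simp
qed

lemma hadamard_reflection_on_leg:
  obtains d where "d \<in> diagonal_matrices"
    "on_leg 0 (phase_hadamard \<beta> ** d ** conj_transpose (phase_hadamard \<beta>)) = hadamard_reflection \<beta>"
proof
  let ?Z = "vector [vector [1, 0], vector [0, -1]] :: complex^2^2"
  show Z: "?Z \<in> diagonal_matrices" by (auto simp: diagonal_matrices_def forall_2)
  show "on_leg 0 (phase_hadamard \<beta> ** ?Z ** conj_transpose (phase_hadamard \<beta>)) = hadamard_reflection \<beta>"
    unfolding on_leg_hadamard_conj[OF Z] by (simp add: cm_add_def cm_scale_def)
qed

lemma hadamard_reflection_in_tensor_power: "hadamard_reflection \<gamma> \<in> tensor_power 1"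
proof -
  obtain d where "on_leg 0 (phase_hadamard \<gamma> ** d ** conj_transpose (phase_hadamard \<gamma>)) = hadamard_reflection \<gamma>"
    by (rule hadamard_reflection_on_leg)
  moreover have "on_leg 0 (phase_hadamard \<gamma> ** d ** conj_transpose (phase_hadamard \<gamma>)) \<in> tensor_power 1"
    by (rule on_leg_tensor_power) simp
  ultimately show ?thesis by simp
qed

lemma hadamard_reflection_in_spin_union: "hadamard_reflection \<gamma> \<in> spin_union"
  by (rule tensor_power_in_spin_union[OF hadamard_reflection_in_tensor_power])

lemma normalized_trace_one_leg:
  assumes "\<And>s t. s 0 = t 0 \<Longrightarrow> f s = f t"
  shows "normalized_trace 1 (monomial f (\<lambda>_. 0)) = (f (\<lambda>_. 1) + f (\<lambda>_. 2)) / 2"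
proof -
  have "(\<Sum>s\<in>{..<1} \<rightarrow>\<^sub>E UNIV. monomial f (\<lambda>_. 0) s s) = (\<Sum>a\<in>UNIV. f (\<lambda>_. a))"
    by (rule sum.reindex_bij_witness[of _ "\<lambda>a. restrict (\<lambda>_. a) {..<1}" "\<lambda>s. s 0"])
      (auto simp: monomial_def fun_eq_iff restrict_def PiE_def extensional_def intro!: assms)
  then show ?thesis by (simp add: normalized_trace_def sum_2)
qed

lemma normalized_trace_hadamard_reflection: "normalized_trace 1 (hadamard_reflection \<gamma>) = 0"
proof -
  have "s \<noteq> shift (single 0) s" for s
  proof
    assume "s = shift (single 0) s"
    from fun_cong[OF this, of 0] show False by (simp add: shift_def)
  qed
  then show ?thesis by (simp add: normalized_trace_def monomial_def)
qed

lemma normalized_trace_hadamard_reflection_mult: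
  "normalized_trace 1 (cm_mult (hadamard_reflection \<alpha>) (hadamard_reflection \<gamma>)) = of_real (cos (\<alpha> - \<gamma>))"
proof -
  have "cis (\<gamma> - \<alpha>) = cnj (cis (\<alpha> - \<gamma>))" by (simp add: cis_cnj)
  then show ?thesis unfolding hadamard_reflection_mult
    by (subst normalized_trace_one_leg) (simp_all add: complex_eq_iff)
qed

section \<open>Generation of the flip-invariant matrices\<close>

text \<open>Decompose \<open>x\<close> into its monomials, one for each set \<open>S\<close> of flipped legs. Each is a diagonal matrix times
  the string formed by \<open>X(\<beta>)\<close> on leg 0 and \<open>X\<close> on the other legs in \<open>S\<close>, and such strings are products of
  generators. Strings are invariant under the flip, so the diagonal factor of an invariant \<open>x\<close> is
  invariant too. An invariant function of finitely many bits depends only on which neighbouring bits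
  agree, and \<open>jones_projection (2 k + 1)\<close> is the indicator of the agreement of bits \<open>k\<close> and \<open>k + 1\<close>.\<close>

lemma flip_fixed_generated:
  assumes add: "\<And>x y. x \<in> B \<Longrightarrow> y \<in> B \<Longrightarrow> cm_add x y \<in> B"
    and scale: "\<And>c x. x \<in> B \<Longrightarrow> cm_scale c x \<in> B"
    and mult: "\<And>x y. x \<in> B \<Longrightarrow> y \<in> B \<Longrightarrow> cm_mult x y \<in> B"
    and one: "cm_one \<in> B"
    and Xb: "hadamard_reflection \<beta> \<in> B"
    and jones: "\<And>j. j \<ge> 1 \<Longrightarrow> jones_projection j \<in> B"
    and x: "x \<in> tensor_power m" "m \<ge> 1" and fixed: "spin_flip \<beta> x = x"
  shows "x \<in> B"
proof -
  have X: "monomial (\<lambda>_. 1) (single j) \<in> B" if "j \<ge> 1" for j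
  proof -
    have "monomial (\<lambda>_. 1) (single j) =
        cm_add (cm_scale 2 (jones_projection (2 * j))) (cm_scale (-1) cm_one)"
      by (auto simp: jones_projection_def J_matrix_def on_leg_eq_monomials cm_add_def cm_scale_def
          cm_one_monomial monomial_def fun_eq_iff)
    then show ?thesis using jones[of "2 * j"] that by (simp add: add scale one)
  qed
  \<comment> \<open>The diagonal part of the string over \<open>S\<close>: a phase is present only if leg 0 is flipped.\<close>
  define \<omega> where "\<omega> S = (\<lambda>s. if S 0 = 0 then 1 else flip_phase \<beta> s)" for S :: "nat \<Rightarrow> 2"
  have strings: "monomial (\<omega> S) S \<in> B" if "\<And>j. j \<ge> k \<Longrightarrow> S j = 0" for k S
    using that
  proof (induction k arbitrary: S)
    case 0
    then have "S = (\<lambda>_. 0)" by auto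
    moreover have "\<omega> (\<lambda>_. 0) = (\<lambda>_. 1)" by (simp add: \<omega>_def)
    ultimately show ?case using one by (simp add: cm_one_monomial)
  next
    case (Suc k)
    show ?case
    proof (cases "S k = 0")
      case True
      then show ?thesis using Suc.prems by (intro Suc.IH) (metis le_antisym not_less_eq_eq)
    next
      case False
      then have "S k = 1" using two_cases by blast
      define S' where "S' = S(k := 0)"
      have S: "S = shift (single k) S'"
        using \<open>S k = 1\<close> by (auto simp: shift_def S'_def)
      have S': "monomial (\<omega> S') S' \<in> B"
        using Suc.prems by (intro Suc.IH) (auto simp: S'_def Suc_le_eq)
      show ?thesis
      proof (cases "k = 0")
        case True
        have "S' = (\<lambda>_. 0)" using True Suc.prems by (auto simp: S'_def)
        then have "S = single 0" using S True by (simp add: shift_def fun_eq_iff)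
        moreover have "\<omega> (single 0) = flip_phase \<beta>" by (simp add: \<omega>_def)
        ultimately show ?thesis using Xb by (simp only:)
      next
        case False
        then have "\<omega> S = \<omega> S'" by (simp add: \<omega>_def S'_def fun_eq_iff)
        then have "monomial (\<omega> S) S = cm_mult (monomial (\<omega> S') S') (monomial (\<lambda>_. 1) (single k))"
          by (simp add: cm_mult_monomial flip: S)
        then show ?thesis using mult[OF S' X] False by simp
      qed
    qed
  qed
  have diag: "monomial g (\<lambda>_. 0) \<in> B"
    if "\<And>s s'. (\<And>j. j \<le> k \<Longrightarrow> s j = s' j) \<Longrightarrow> g s = g s'" "\<And>s. g (flip s) = g s" for k g
    using that
  proof (induction k arbitrary: g)
    case 0
    have "g s = g (\<lambda>_. 0)" for s
    proof (cases "s 0 = 0")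
      case True
      then show ?thesis by (intro 0(1)) auto
    next
      case False
      then have "g (flip s) = g (\<lambda>_. 0)"
        using two_cases[of "s 0"] by (intro 0(1)) (auto simp: shift_def)
      then show ?thesis by (simp add: 0(2))
    qed
    then have "g = (\<lambda>s. g (\<lambda>_. 0) * 1)" by auto
    then have "monomial g (\<lambda>_. 0) = cm_scale (g (\<lambda>_. 0)) cm_one"
      unfolding cm_one_monomial cm_scale_monomial by metis
    then show ?case using scale one by simp
  next
    case (Suc k)
    \<comment> \<open>The last bit equals its neighbour (\<open>a = 0\<close>) or differs from it (\<open>a = 1\<close>); in both cases one bit fewer is needed.\<close>
    define g' where "g' a s = g (s(Suc k := s k + a))" for a s
    have g': "monomial (g' a) (\<lambda>_. 0) \<in> B" for a
    proof (rule Suc.IH)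
      show "g' a s = g' a s'" if "\<And>j. j \<le> k \<Longrightarrow> s j = s' j" for s s'
        unfolding g'_def using that by (intro Suc.prems(1)) (auto simp: le_Suc_eq)
      show "g' a (flip s) = g' a s" for s
      proof -
        have "(flip s)(Suc k := flip s k + a) = flip (s(Suc k := s k + a))"
          by (auto simp: shift_def fun_eq_iff add_ac)
        then show ?thesis unfolding g'_def by (simp only: Suc.prems(2))
      qed
    qed
    define e where "e s = (of_bool (s (Suc k) = s k) :: complex)" for s :: "nat \<Rightarrow> 2"
    have e: "monomial e (\<lambda>_. 0) \<in> B"
      using jones[of "2 * k + 1"] unfolding jones_projection_odd e_def by simp
    have "monomial (\<lambda>s. 1 + (-1) * e s) (\<lambda>_. 0) \<in> B"
      using add[OF one scale[OF e, of "-1"]]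
      by (simp add: cm_one_monomial cm_scale_monomial cm_add_monomial)
    from add[OF mult[OF e g'[of 0]] mult[OF this g'[of 1]]]
    have "monomial (\<lambda>s. e s * g' 0 s + (1 + (-1) * e s) * g' 1 s) (\<lambda>_. 0) \<in> B"
      by (simp add: cm_mult_monomial cm_add_monomial)
    moreover have "e s * g' 0 s + (1 + (-1) * e s) * g' 1 s = g s" for s
    proof (cases "s (Suc k) = s k")
      case True
      then show ?thesis by (simp add: e_def g'_def fun_upd_idem)
    next
      case False
      then have "s (Suc k) = s k + 1" using two_cases[of "s k"] two_cases[of "s (Suc k)"] by auto
      then show ?thesis using False by (simp add: e_def g'_def fun_upd_idem)
    qed
    ultimately show ?case by simp
  qed
  let ?F = "{S :: nat \<Rightarrow> 2. \<forall>j\<ge>m. S j = 0}"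
  have fin: "finite ?F" using finite_agreeing_tail[of m "\<lambda>_. 0"] by simp
  have term_in: "monomial (\<lambda>s. x s (shift S s)) S \<in> B" if S: "S \<in> ?F" for S
  proof -
    define g where "g s = x s (shift S s) * cnj (\<omega> S s)" for s
    have "monomial g (\<lambda>_. 0) \<in> B"
    proof (rule diag[of "m - 1"])
      fix s s' :: "nat \<Rightarrow> 2" assume "\<And>j. j \<le> m - 1 \<Longrightarrow> s j = s' j"
      then have ss': "\<And>j. j < m \<Longrightarrow> s j = s' j" by auto
      have "x s (shift S s) = x s' (shift S s')"
        using S by (intro tensor_power_local[OF x(1)]) (auto simp: shift_def ss')
      moreover have "\<omega> S s = \<omega> S s'" using ss'[of 0] x(2) by (auto simp: \<omega>_def flip_phase_def)
      ultimately show "g s = g s'" by (simp add: g_def)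
    next
      fix s
      have "x s (shift S s) =
          flip_phase \<beta> s * x (flip s) (flip (shift S s)) * cnj (flip_phase \<beta> (shift S s))"
        using fixed by (metis spin_flip_def)
      moreover have "flip (shift S s) = shift S (flip s)" by (simp add: shift_def add_ac)
      ultimately have "g s = x (flip s) (shift S (flip s)) *
          (flip_phase \<beta> s * cnj (flip_phase \<beta> (shift S s)) * cnj (\<omega> S s))"
        by (simp add: g_def mult_ac)
      also have "flip_phase \<beta> s * cnj (flip_phase \<beta> (shift S s)) * cnj (\<omega> S s) = cnj (\<omega> S (flip s))"
        by (simp add: \<omega>_def flip_phase_shift mult.assoc)
      finally show "g (flip s) = g s" by (simp add: g_def)
    qed
    moreover have "monomial (\<omega> S) S \<in> B" using S by (intro strings) auto
    ultimately have "cm_mult (monomial g (\<lambda>_. 0)) (monomial (\<omega> S) S) \<in> B" by (rule mult)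
    moreover have "g s * \<omega> S s = x s (shift S s)" for s
      by (auto simp: g_def \<omega>_def mult.assoc)
    moreover have "shift S (\<lambda>_. 0) = S" by (simp add: shift_def)
    ultimately show ?thesis by (simp add: cm_mult_monomial)
  qed
  have sum_in: "(\<lambda>s t. \<Sum>S\<in>F. monomial (\<lambda>s. x s (shift S s)) S s t) \<in> B" if "F \<subseteq> ?F" for F
    using finite_subset[OF that fin] that
  proof (induction F)
    case empty
    have "(\<lambda>s t :: nat \<Rightarrow> 2. 0) = cm_scale 0 cm_one" by (simp add: cm_scale_def)
    then show ?case using scale[OF one, of 0] by simp
  next
    case (insert S F)
    then show ?case using add[OF term_in[of S]] by (simp add: cm_add_def)
  qed
  have "x s t = (\<Sum>S\<in>?F. monomial (\<lambda>s. x s (shift S s)) S s t)" for s t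
  proof -
    have eq: "t = shift S s \<longleftrightarrow> S = shift s t" for S
      by (auto simp: shift_def fun_eq_iff add_ac)
    have "(\<Sum>S\<in>?F. monomial (\<lambda>s. x s (shift S s)) S s t) = (\<Sum>S\<in>?F. if S = shift s t then x s t else 0)"
      by (rule sum.cong) (auto simp: monomial_def eq simp flip: eq)
    also have "\<dots> = (if shift s t \<in> ?F then x s t else 0)" using fin by (simp add: sum.delta)
    also have "\<dots> = x s t"
    proof (cases "shift s t \<in> ?F")
      case False
      then obtain j where "j \<ge> m" "t j + s j \<noteq> 0" by (auto simp: shift_def)
      moreover from this have "s j \<noteq> t j" by auto
      ultimately show ?thesis using tensor_power_zero[OF x(1)] False by simp
    qed simp
    finally show ?thesis by simp
  qed
  then have "x = (\<lambda>s t. \<Sum>S\<in>?F. monomial (\<lambda>s. x s (shift S s)) S s t)" by (intro ext)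
  then show ?thesis using sum_in[of ?F] by simp
qed

section \<open>The GNS representation\<close>

lemma gns_representationD:
  assumes "gns_representation \<pi> \<Omega>"
  shows "x \<in> spin_union \<Longrightarrow> complex_linear_op (\<pi> x)" "\<pi> cm_one = id_blinfun"
    "x \<in> spin_union \<Longrightarrow> y \<in> spin_union \<Longrightarrow> \<pi> (cm_add x y) = \<pi> x + \<pi> y"
    "x \<in> spin_union \<Longrightarrow> \<pi> (cm_scale c x) = scaleC_op c (\<pi> x)"
    "x \<in> spin_union \<Longrightarrow> y \<in> spin_union \<Longrightarrow> \<pi> (cm_mult x y) = \<pi> x o\<^sub>L \<pi> y"
    "x \<in> spin_union \<Longrightarrow> is_adjoint (\<pi> (cm_adjoint x)) (\<pi> x)"
    "closure ((\<lambda>x. \<pi> x \<Omega>) ` spin_union) = UNIV"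
    "x \<in> tensor_power m \<Longrightarrow> cinner (\<pi> x \<Omega>) \<Omega> = normalized_trace m x"
  using assms unfolding gns_representation_def by blast+

lemma spin_factor_von_neumann:
  assumes gns: "gns_representation \<pi> \<Omega>"
  shows "von_neumann_algebra (spin_factor \<pi>)"
  unfolding spin_factor_def
proof (rule von_neumann_algebra_sot_closure)
  note D = gns_representationD[OF gns]
  show "complex_linear_op T" if "T \<in> \<pi> ` spin_union" for T using D(1) that by blast
  show "id_blinfun \<in> \<pi> ` spin_union"
    using D(2) tensor_power_in_spin_union[OF cm_one_tensor_power] by (metis imageI)
  show "S + T \<in> \<pi> ` spin_union" "S o\<^sub>L T \<in> \<pi> ` spin_union"
    if "S \<in> \<pi> ` spin_union" "T \<in> \<pi> ` spin_union" for S T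
    using that D(3,5) spin_union_closed(3,4) by (metis (no_types, lifting) imageE imageI)+
  show "scaleC_op c T \<in> \<pi> ` spin_union" "\<exists>S\<in>\<pi> ` spin_union. is_adjoint S T"
    if "T \<in> \<pi> ` spin_union" for c T
    using that D(4,6) spin_union_closed(1,2) by (metis (no_types, lifting) imageE imageI)+
qed

lemma pi_in_spin_factor: "x \<in> spin_union \<Longrightarrow> \<pi> x \<in> spin_factor \<pi>"
  unfolding spin_factor_def
  using closure_of_subset[of "\<pi> ` spin_union" strong_operator_topology]
  by (auto simp: strong_operator_topology_topspace)

lemma gns_norm_square:
  assumes gns: "gns_representation \<pi> \<Omega>" and x: "x \<in> tensor_power m"
  shows "of_real ((norm (\<pi> x \<Omega>))\<^sup>2) = normalized_trace m (cm_mult (cm_adjoint x) x)"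
proof -
  note D = gns_representationD[OF gns]
  have x': "x \<in> spin_union" "cm_adjoint x \<in> spin_union"
    using x cm_adjoint_tensor_power tensor_power_in_spin_union by blast+
  have "of_real ((norm (\<pi> x \<Omega>))\<^sup>2) = cinner (\<pi> x \<Omega>) (\<pi> x \<Omega>)" by (simp add: cinner_self)
  also have "\<dots> = cinner (\<pi> (cm_mult (cm_adjoint x) x) \<Omega>) \<Omega>"
    using is_adjoint_sym[OF D(6)[OF x'(1)]] by (simp add: D(5) x' is_adjoint_def)
  finally show ?thesis
    by (simp add: D(8)[OF cm_mult_tensor_power[OF cm_adjoint_tensor_power[OF x] x]])
qed

text \<open>The squares of the two norms are the traces of \<open>x x\<^sup>*\<close> and \<open>x\<^sup>* x\<close>.\<close>

lemma gns_norm_adjoint: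
  assumes gns: "gns_representation \<pi> \<Omega>" and "x \<in> spin_union"
  shows "norm (\<pi> (cm_adjoint x) \<Omega>) = norm (\<pi> x \<Omega>)"
proof -
  obtain m where m: "x \<in> tensor_power m" using assms(2) unfolding spin_union_eq by blast
  note m' = cm_adjoint_tensor_power[OF m]
  have "complex_of_real ((norm (\<pi> (cm_adjoint x) \<Omega>))\<^sup>2) = of_real ((norm (\<pi> x \<Omega>))\<^sup>2)"
    unfolding gns_norm_square[OF gns m] gns_norm_square[OF gns m'] cm_adjoint_adjoint
    by (rule normalized_trace_commute[OF m m'])
  then show ?thesis by (simp only: of_real_eq_iff) (simp add: power2_eq_iff_nonneg)
qed

text \<open>Since the trace makes the adjoint isometric on \<open>\<pi> x \<Omega>\<close>, right multiplication by \<open>y\<close> is as bounded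
  as left multiplication by \<open>y\<^sup>*\<close>.\<close>

lemma gns_right_bounded:
  assumes gns: "gns_representation \<pi> \<Omega>" and x: "x \<in> spin_union" and y: "y \<in> spin_union"
  shows "norm (\<pi> x (\<pi> y \<Omega>)) \<le> norm (\<pi> (cm_adjoint y)) * norm (\<pi> x \<Omega>)"
proof -
  note D = gns_representationD[OF gns]
  have xy: "cm_mult x y \<in> spin_union" by (rule spin_union_closed(4)[OF x y])
  have "is_adjoint (\<pi> (cm_adjoint (cm_mult x y))) (\<pi> x o\<^sub>L \<pi> y)"
    using D(6)[OF xy] by (simp add: D(5) x y)
  then have *: "\<pi> (cm_adjoint (cm_mult x y)) = \<pi> (cm_adjoint y) o\<^sub>L \<pi> (cm_adjoint x)"
    using is_adjoint_compose[OF D(6)[OF x] D(6)[OF y]] by (rule is_adjoint_unique)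
  have "norm (\<pi> x (\<pi> y \<Omega>)) = norm (\<pi> (cm_mult x y) \<Omega>)" by (simp add: D(5) x y)
  also have "\<dots> = norm (\<pi> (cm_adjoint y) (\<pi> (cm_adjoint x) \<Omega>))"
    by (simp flip: gns_norm_adjoint[OF gns xy] add: *)
  also have "\<dots> \<le> norm (\<pi> (cm_adjoint y)) * norm (\<pi> (cm_adjoint x) \<Omega>)" by (rule norm_blinfun)
  finally show ?thesis by (simp add: gns_norm_adjoint[OF gns x])
qed

text \<open>Approximating \<open>T\<close> strongly on the two vectors \<open>\<Omega>\<close> and \<open>\<pi> y \<Omega>\<close> transfers the bound of
  right multiplication by \<open>y\<close> to \<open>T\<close>. Hence \<open>T\<close> vanishes on all \<open>\<pi> y \<Omega>\<close>, and these are dense.\<close>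

lemma gns_separating:
  assumes gns: "gns_representation \<pi> \<Omega>" and T: "T \<in> spin_factor \<pi>" and "T \<Omega> = 0"
  shows "T = 0"
proof (rule blinfun_eq_on_dense[OF gns_representationD(7)[OF gns]])
  fix z assume "z \<in> (\<lambda>x. \<pi> x \<Omega>) ` spin_union"
  then obtain y where y: "y \<in> spin_union" "z = \<pi> y \<Omega>" by blast
  define K where "K = norm (\<pi> (cm_adjoint y))"
  have "K \<ge> 0" by (simp add: K_def)
  have "norm (T z) \<le> 0 + e" if "e > 0" for e
  proof -
    define e' where "e' = e / (K + 1)"
    have "e' > 0" using that \<open>K \<ge> 0\<close> by (simp add: e'_def)
    then have "\<exists>S\<in>\<pi> ` spin_union. \<forall>x\<in>{\<Omega>, z}. norm (S x - T x) < e'"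
      using T unfolding spin_factor_def sot_closure_iff by (meson finite.emptyI finite.insertI)
    then obtain x where x: "x \<in> spin_union" "norm (\<pi> x \<Omega>) < e'" "norm (\<pi> x z - T z) < e'"
      using \<open>T \<Omega> = 0\<close> by auto
    have "norm (T z) \<le> norm (\<pi> x z) + norm (\<pi> x z - T z)"
      by (metis norm_triangle_sub norm_minus_commute)
    also have "\<dots> \<le> K * norm (\<pi> x \<Omega>) + e'"
      using gns_right_bounded[OF gns x(1) y(1)] x(3) unfolding K_def y(2) by linarith
    also have "\<dots> \<le> K * e' + e'" using x(2) \<open>K \<ge> 0\<close> by (simp add: mult_left_mono)
    also have "\<dots> = e' * (K + 1)" by (simp add: algebra_simps)
    also have "\<dots> = e" using \<open>K \<ge> 0\<close> by (simp add: e'_def)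
    finally show ?thesis by simp
  qed
  then have "norm (T z) \<le> 0" by (rule field_le_epsilon)
  then show "blinfun_apply T z = blinfun_apply 0 z" by simp
qed

section \<open>Spin model subfactors as fixed-point algebras\<close>

definition implements_flip ::
    "(2 config_matrix \<Rightarrow> ('h::complex_hilbert_space \<Rightarrow>\<^sub>L 'h)) \<Rightarrow> 'h \<Rightarrow> real \<Rightarrow> ('h \<Rightarrow>\<^sub>L 'h) \<Rightarrow> bool" where
  "implements_flip \<pi> \<Omega> \<beta> U \<longleftrightarrow>
     is_adjoint U U \<and> U o\<^sub>L U = id_blinfun \<and> U \<Omega> = \<Omega> \<and>
     (\<forall>x\<in>spin_union. U o\<^sub>L \<pi> x o\<^sub>L U = \<pi> (spin_flip \<beta> x))"

lemma implements_flipD: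
  assumes "implements_flip \<pi> \<Omega> \<beta> U"
  shows "is_adjoint U U" "U o\<^sub>L U = id_blinfun" "U \<Omega> = \<Omega>"
    "x \<in> spin_union \<Longrightarrow> U o\<^sub>L \<pi> x o\<^sub>L U = \<pi> (spin_flip \<beta> x)"
  using assms unfolding implements_flip_def by blast+

text \<open>The flip preserves the trace, so \<open>\<pi> x \<Omega> \<mapsto> \<pi> (spin_flip \<beta> x) \<Omega>\<close> is isometric and extends to the whole
  space. The flip has period two and is multiplicative; the extension is therefore an involution, and
  conjugation by it implements the flip.\<close>

lemma implements_flip_exists:
  assumes gns: "gns_representation \<pi> \<Omega>"
  obtains U where "implements_flip \<pi> \<Omega> \<beta> U"
proof -
  note D = gns_representationD[OF gns]
  let ?G = "(\<lambda>x. (\<pi> x \<Omega>, \<pi> (spin_flip \<beta> x) \<Omega>)) ` spin_union"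
  have iso: "norm (\<pi> (spin_flip \<beta> x) \<Omega>) = norm (\<pi> x \<Omega>)" if x: "x \<in> spin_union" for x
  proof -
    obtain m where m: "m \<ge> 1" "x \<in> tensor_power m" using spin_unionE[OF x x] by blast
    note m' = spin_flip_tensor_power[OF m(2,1), of \<beta>]
    have "complex_of_real ((norm (\<pi> (spin_flip \<beta> x) \<Omega>))\<^sup>2) = of_real ((norm (\<pi> x \<Omega>))\<^sup>2)"
      unfolding gns_norm_square[OF gns m(2)] gns_norm_square[OF gns m']
      by (simp add: m normalized_trace_spin_flip cm_mult_tensor_power cm_adjoint_tensor_power
          flip: spin_flip_adjoint spin_flip_mult)
    then show ?thesis by (simp only: of_real_eq_iff) (simp add: power2_eq_iff_nonneg)
  qed
  obtain U where U: "complex_linear_op U" "\<And>x y. (x, y) \<in> ?G \<Longrightarrow> U x = y"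
  proof (rule isometry_extension[of ?G])
    show "(x + x', y + y') \<in> ?G" if xy: "(x, y) \<in> ?G" "(x', y') \<in> ?G" for x y x' y'
    proof -
      obtain a b where ab: "a \<in> spin_union" "b \<in> spin_union" "x = \<pi> a \<Omega>" "x' = \<pi> b \<Omega>"
        "y = \<pi> (spin_flip \<beta> a) \<Omega>" "y' = \<pi> (spin_flip \<beta> b) \<Omega>" using xy by auto
      then have "(x + x', y + y') = (\<pi> (cm_add a b) \<Omega>, \<pi> (spin_flip \<beta> (cm_add a b)) \<Omega>)"
        by (simp add: D(3) spin_flip_add spin_flip_in_spin_union blinfun.add_left)
      then show ?thesis using spin_union_closed(3)[OF ab(1,2)] by blast
    qed
    show "(c *\<^sub>C x, c *\<^sub>C y) \<in> ?G" if xy: "(x, y) \<in> ?G" for c x y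
    proof -
      obtain a where a: "a \<in> spin_union" "x = \<pi> a \<Omega>" "y = \<pi> (spin_flip \<beta> a) \<Omega>" using xy by auto
      then have "(c *\<^sub>C x, c *\<^sub>C y) = (\<pi> (cm_scale c a) \<Omega>, \<pi> (spin_flip \<beta> (cm_scale c a)) \<Omega>)"
        by (simp add: D(4) spin_flip_scale spin_flip_in_spin_union)
      then show ?thesis using spin_union_closed(1)[OF a(1)] by blast
    qed
    show "norm y = norm x" if "(x, y) \<in> ?G" for x y using iso that by auto
    show "closure (fst ` ?G) = UNIV" using D(7) by (simp add: image_image)
  qed blast
  have U': "U (\<pi> x \<Omega>) = \<pi> (spin_flip \<beta> x) \<Omega>" if "x \<in> spin_union" for x
    using U(2) that by blast
  have inv: "U o\<^sub>L U = id_blinfun"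
    by (rule blinfun_eq_on_dense[OF D(7)]) (auto simp: U' spin_flip_in_spin_union)
  have one: "cm_one \<in> spin_union" by (rule tensor_power_in_spin_union[OF cm_one_tensor_power])
  have "closure ((\<lambda>x. \<pi> x \<Omega>) ` spin_union) \<subseteq> {x. norm (U x) = norm x}"
    by (rule closure_minimal) (auto simp: U' iso intro!: closed_Collect_eq continuous_intros)
  then have "is_adjoint U U" using D(7) by (intro isometric_involution_self_adjoint U(1) inv) auto
  moreover have "U \<Omega> = \<Omega>" using U'[OF one] by (simp add: D(2))
  moreover have "U o\<^sub>L \<pi> x o\<^sub>L U = \<pi> (spin_flip \<beta> x)" if x: "x \<in> spin_union" for x
  proof (rule blinfun_eq_on_dense[OF D(7)])
    fix z assume "z \<in> (\<lambda>x. \<pi> x \<Omega>) ` spin_union"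
    then obtain y where y: "y \<in> spin_union" "z = \<pi> y \<Omega>" by blast
    have "U (\<pi> (cm_mult x (spin_flip \<beta> y)) \<Omega>) = \<pi> (cm_mult (spin_flip \<beta> x) y) \<Omega>"
      by (simp add: U' x y spin_flip_in_spin_union spin_union_closed(4) spin_flip_mult)
    then show "blinfun_apply (U o\<^sub>L \<pi> x o\<^sub>L U) z = blinfun_apply (\<pi> (spin_flip \<beta> x)) z"
      by (simp add: y U' D(5) x spin_flip_in_spin_union)
  qed
  ultimately show thesis using that inv unfolding implements_flip_def by blast
qed

lemma flip_preserves_spin_factor:
  assumes U: "implements_flip \<pi> \<Omega> \<beta> U" and T: "T \<in> spin_factor \<pi>"
  shows "U o\<^sub>L T o\<^sub>L U \<in> spin_factor \<pi>"
  unfolding spin_factor_def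
proof (rule sot_continuous_image[where f = "\<lambda>T. U o\<^sub>L T o\<^sub>L U"])
  show "continuous_map strong_operator_topology euclidean (\<lambda>S. blinfun_apply (U o\<^sub>L S o\<^sub>L U) x)" for x
    using sot_continuous_eval_left[of U "U x"] by simp
  show "U o\<^sub>L S o\<^sub>L U \<in> \<pi> ` spin_union" if "S \<in> \<pi> ` spin_union" for S
    using that implements_flipD(4)[OF U] spin_flip_in_spin_union by auto
qed (use T in \<open>simp add: spin_factor_def\<close>)

text \<open>The generators are invariant, which gives one inclusion. For the other, let \<open>N\<close> be a von Neumann algebra
  containing them. Averaging over the flip is strongly continuous and maps \<open>\<pi> x\<close> to the image of an
  invariant matrix, which lies in \<open>N\<close>; therefore it maps the whole of \<open>R\<close> into \<open>N\<close>, and it does not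
  move invariant elements.\<close>

lemma spin_subfactor_eq_fixed_points:
  assumes gns: "gns_representation \<pi> \<Omega>" and U: "implements_flip \<pi> \<Omega> \<beta> U"
  shows "spin_subfactor \<pi> (phase_hadamard \<beta>) = {T \<in> spin_factor \<pi>. U o\<^sub>L T o\<^sub>L U = T}" (is "_ = ?F")
proof
  note D = gns_representationD[OF gns] and UD = implements_flipD[OF U]
  let ?u = "phase_hadamard \<beta>"
  let ?X = "{\<pi> (on_leg 0 (?u ** d ** conj_transpose ?u)) | d. d \<in> diagonal_matrices} \<union>
      {\<pi> (jones_projection j) | j. 1 \<le> j}"
  have "?X \<subseteq> ?F"
  proof -
    have "\<pi> x \<in> ?F" if "x \<in> spin_union" "spin_flip \<beta> x = x" for x
      using that by (simp add: pi_in_spin_factor UD(4))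
    moreover have "spin_flip \<beta> (on_leg 0 (?u ** d ** conj_transpose ?u)) = on_leg 0 (?u ** d ** conj_transpose ?u)"
      if "d \<in> diagonal_matrices" for d
      by (simp add: on_leg_hadamard_conj[OF that] spin_flip_add spin_flip_scale spin_flip_hadamard_reflection)
    ultimately show ?thesis
      using spin_flip_jones_projection jones_projection_in_spin_union on_leg_in_spin_union by blast
  qed
  then show "spin_subfactor \<pi> ?u \<subseteq> ?F"
    unfolding spin_subfactor_def generated_von_neumann_algebra_def
    by (intro hull_minimal von_neumann_algebra_fixed_points spin_factor_von_neumann[OF gns] UD)
  show "?F \<subseteq> spin_subfactor \<pi> ?u"
    unfolding spin_subfactor_def generated_von_neumann_algebra_def hull_def
  proof (intro subsetI InterI)
    fix T N
    assume "T \<in> ?F" and N: "N \<in> {N. von_neumann_algebra N \<and> ?X \<subseteq> N}"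
    then have T: "T \<in> spin_factor \<pi>" "U o\<^sub>L T o\<^sub>L U = T" by auto
    have vN: "von_neumann_algebra N" and gens: "?X \<subseteq> N" using N by auto
    note ND = von_neumann_algebraD[OF vN]
    define B where "B = {x \<in> spin_union. \<pi> x \<in> N}"
    have one: "cm_one \<in> B"
      using ND(2) tensor_power_in_spin_union[OF cm_one_tensor_power] by (simp add: B_def D(2))
    obtain d where d: "d \<in> diagonal_matrices"
      "on_leg 0 (?u ** d ** conj_transpose ?u) = hadamard_reflection \<beta>"
      by (rule hadamard_reflection_on_leg)
    have "on_leg 0 (?u ** d ** conj_transpose ?u) \<in> B"
      using gens d(1) by (auto simp: B_def on_leg_in_spin_union)
    then have X: "hadamard_reflection \<beta> \<in> B" by (simp only: d(2))
    have jones: "jones_projection j \<in> B" if "j \<ge> 1" for j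
      using gens that by (auto simp: B_def jones_projection_in_spin_union)
    have fixed_in_N: "\<pi> x \<in> N" if x: "x \<in> spin_union" "spin_flip \<beta> x = x" for x
    proof -
      obtain m where m: "m \<ge> 1" "x \<in> tensor_power m" using spin_unionE[OF x(1) x(1)] by blast
      have "x \<in> B"
        by (rule flip_fixed_generated[OF _ _ _ one X jones m(2,1) x(2)])
          (auto simp: B_def spin_union_closed D(3-5) intro: ND)
      then show ?thesis by (simp add: B_def)
    qed
    let ?f = "\<lambda>T. (1/2) *\<^sub>R (T + (U o\<^sub>L T o\<^sub>L U))"
    have "?f T \<in> strong_operator_topology closure_of N"
    proof (rule sot_continuous_image[where f = ?f and A = "\<pi> ` spin_union"])
      show "continuous_map strong_operator_topology euclidean (\<lambda>S. blinfun_apply (?f S) x)" for x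
      proof -
        have "continuous_map strong_operator_topology euclidean
            (\<lambda>S. ((1/2) *\<^sub>R id_blinfun) (blinfun_apply S x) + ((1/2) *\<^sub>R U) (S (U x)))"
          by (intro continuous_map_add sot_continuous_eval_left)
        then show ?thesis by (simp add: blinfun.scaleR_left blinfun.add_left scaleR_add_right)
      qed
      show "?f S \<in> N" if S: "S \<in> \<pi> ` spin_union" for S
      proof -
        obtain x where x: "x \<in> spin_union" "S = \<pi> x" using S by blast
        define y where "y = cm_scale (1/2) (cm_add x (spin_flip \<beta> x))"
        have "y \<in> spin_union" by (simp add: y_def spin_union_closed spin_flip_in_spin_union x)
        moreover have "spin_flip \<beta> y = y"
          by (simp add: y_def spin_flip_scale spin_flip_add) (simp add: cm_add_def add.commute)
        ultimately have "\<pi> y \<in> N" by (rule fixed_in_N)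
        moreover have "\<pi> y = ?f S"
          using scaleC_op_of_real[of "1/2"]
          by (simp add: y_def D x UD(4) spin_union_closed spin_flip_in_spin_union)
        ultimately show ?thesis by simp
      qed
    qed (use T(1) in \<open>simp add: spin_factor_def\<close>)
    moreover have "?f T = T" by (rule blinfun_eqI) (simp add: T(2) flip: scaleR_2)
    ultimately show "T \<in> N" using closure_of_closedin[OF ND(6)] by simp
  qed
qed

section \<open>The Pimsner-Popa constant\<close>

text \<open>The supremum is attained at \<open>1/2\<close>, where \<open>E T - T/2\<close> is half of the flip of \<open>T\<close>. The bound from
  above tests positivity of \<open>E p - t p\<close>, for the projection \<open>p = (1 + X(\<alpha>)) / 2\<close>, on one vector \<open>\<xi>\<close>.\<close>

lemma phase_hadamard_pimsner_popa:
  fixes \<pi> :: "2 config_matrix \<Rightarrow> ('h::complex_hilbert_space \<Rightarrow>\<^sub>L 'h)"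
  assumes gns: "gns_representation \<pi> \<Omega>" and distinct: "sin (\<beta> - \<alpha>) \<noteq> 0"
  shows "pimsner_popa_constant (spin_factor \<pi>) (vector_trace \<Omega>)
      (spin_subfactor \<pi> (phase_hadamard \<alpha>)) (spin_subfactor \<pi> (phase_hadamard \<beta>)) = 1 / 2"
proof -
  note D = gns_representationD[OF gns]
  let ?M = "spin_factor \<pi>" and ?P = "spin_subfactor \<pi> (phase_hadamard \<alpha>)"
    and ?Q = "spin_subfactor \<pi> (phase_hadamard \<beta>)"
  obtain V where V: "implements_flip \<pi> \<Omega> \<alpha> V" by (rule implements_flip_exists[OF gns])
  obtain U where U: "implements_flip \<pi> \<Omega> \<beta> U" by (rule implements_flip_exists[OF gns])
  note UD = implements_flipD[OF U] and VD = implements_flipD[OF V]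
  have P: "?P = {T \<in> ?M. V o\<^sub>L T o\<^sub>L V = T}" by (rule spin_subfactor_eq_fixed_points[OF gns V])
  have Q: "?Q = {T \<in> ?M. U o\<^sub>L T o\<^sub>L U = T}" by (rule spin_subfactor_eq_fixed_points[OF gns U])
  note M = spin_factor_von_neumann[OF gns]
  define E where "E = (\<lambda>T\<in>?M. (1/2) *\<^sub>R (T + (U o\<^sub>L T o\<^sub>L U)))"
  have E: "is_conditional_expectation ?M (vector_trace \<Omega>) ?Q E"
    unfolding E_def Q
    by (rule involution_conditional_expectation[OF M UD(1,2,3) flip_preserves_spin_factor[OF U]])
  have cond_exp: "conditional_expectation ?M (vector_trace \<Omega>) ?Q = E"
    unfolding conditional_expectation_def
  proof (rule the_equality, rule E)
    fix F assume F: "is_conditional_expectation ?M (vector_trace \<Omega>) ?Q F"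
    have "von_neumann_algebra ?Q" unfolding Q by (rule von_neumann_algebra_fixed_points[OF M UD(1,2)])
    moreover have "?Q \<subseteq> ?M" unfolding Q by blast
    ultimately show "F = E"
      using gns_separating[OF gns] F E by (rule conditional_expectation_unique[OF M])
  qed
  let ?S = "{t. 0 \<le> t \<and> (\<forall>x\<in>?P. positive_op x \<longrightarrow> positive_op (E x - t *\<^sub>R x))}"
  have "1/2 \<in> ?S"
  proof (intro CollectI conjI ballI impI)
    fix T assume "T \<in> ?P" and T: "positive_op T"
    then have "T \<in> ?M" unfolding P by simp
    then have "E T - (1/2) *\<^sub>R T = (1/2) *\<^sub>R (U o\<^sub>L T o\<^sub>L U)"
      by (simp add: E_def scaleR_add_right)
    then show "positive_op (E T - (1/2) *\<^sub>R T)"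
      by (simp add: positive_op_scaleR positive_op_conjugate[OF UD(1) T])
  qed simp
  moreover have "t \<le> 1/2" if t: "t \<in> ?S" for t
  proof -
    let ?\<gamma> = "2 * \<beta> - \<alpha>"
    define A where "A = \<pi> (hadamard_reflection \<alpha>)"
    define B where "B = \<pi> (hadamard_reflection ?\<gamma>)"
    define p where "p = (1/2) *\<^sub>R (id_blinfun + A)"
    note in_union = hadamard_reflection_in_spin_union
    have invol: "\<pi> (hadamard_reflection \<gamma>) (\<pi> (hadamard_reflection \<gamma>) x) = x" for \<gamma> x
    proof -
      have "cm_mult (hadamard_reflection \<gamma>) (hadamard_reflection \<gamma>) = cm_one"
        unfolding hadamard_reflection_mult by (simp add: cm_one_monomial)
      then have "\<pi> (hadamard_reflection \<gamma>) o\<^sub>L \<pi> (hadamard_reflection \<gamma>) = id_blinfun"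
        by (metis D(2,5) in_union)
      then show ?thesis by (metis blinfun_apply_blinfun_compose blinfun_apply_id_blinfun id_apply)
    qed
    have A_adj: "is_adjoint A A"
      using D(6)[OF in_union[of \<alpha>]] unfolding hadamard_reflection_adjoint A_def .
    have pp: "cinner (p x) x = cinner (p x) (p x)" for x
    proof -
      have "p (p x) = p x"
        by (simp add: p_def blinfun.add_left blinfun.scaleR_left blinfun.add_right blinfun.scaleR_right A_def invol)
          (simp add: add.commute flip: scaleR_2)
      moreover have "cinner (p x) y = cinner x (p y)" for x y
        using A_adj by (simp add: p_def is_adjoint_def blinfun.add_left blinfun.scaleR_left
          cinner_add_left cinner_add_right cinner_scaleR_left cinner_scaleR_right)
      ultimately show ?thesis by metis
    qed
    have p_pos: "positive_op p"
      unfolding positive_op_def pp by (simp add: cinner_self)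
    have p_in: "p \<in> ?P"
    proof -
      have "V (A (V x)) = A x" for x
        using arg_cong[OF VD(4)[OF in_union[of \<alpha>]], of "\<lambda>S. blinfun_apply S x"]
        by (simp add: spin_flip_hadamard_reflection A_def)
      moreover have "V (V x) = x" for x
        using VD(2) by (metis blinfun_apply_blinfun_compose blinfun_apply_id_blinfun id_apply)
      ultimately have "V o\<^sub>L p o\<^sub>L V = p"
        by (intro blinfun_eqI) (simp add: p_def blinfun.add_left blinfun.scaleR_left
          blinfun.add_right blinfun.scaleR_right)
      moreover have "p \<in> ?M"
        unfolding p_def A_def by (intro von_neumann_algebraD[OF M] pi_in_spin_factor in_union)
      ultimately show ?thesis unfolding P by simp
    qed
    have E_p: "E p = (1/2) *\<^sub>R (p + (1/2) *\<^sub>R (id_blinfun + B))"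
    proof -
      have UAU: "U (A (U x)) = B x" for x
        using arg_cong[OF UD(4)[OF in_union[of \<alpha>]], of "\<lambda>S. blinfun_apply S x"]
        by (simp add: spin_flip_hadamard_reflection A_def B_def)
      have UU: "U (U x) = x" for x
        using UD(2) by (metis blinfun_apply_blinfun_compose blinfun_apply_id_blinfun id_apply)
      have "U o\<^sub>L p o\<^sub>L U = (1/2) *\<^sub>R (id_blinfun + B)"
        by (rule blinfun_eqI) (simp add: p_def blinfun.add_left blinfun.scaleR_left
          blinfun.add_right blinfun.scaleR_right UAU UU)
      moreover have "p \<in> ?M" using p_in unfolding P by simp
      ultimately show ?thesis by (simp add: E_def)
    qed
    \<comment> \<open>\<open>B\<close> has eigenvalue \<open>-1\<close> at \<open>\<xi>\<close>, so \<open>\<xi>\<close> is killed by the flip of \<open>p\<close>.\<close>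
    define \<xi> where "\<xi> = \<Omega> - B \<Omega>"
    have B\<xi>: "B \<xi> = - \<xi>" by (simp add: \<xi>_def blinfun.diff_right B_def invol)
    have tr: "cinner (\<pi> (hadamard_reflection \<gamma>) \<Omega>) \<Omega> = 0" for \<gamma>
      unfolding D(8)[OF hadamard_reflection_in_tensor_power]
      by (rule normalized_trace_hadamard_reflection)
    have tr1: "cinner \<Omega> \<Omega> = 1"
    proof -
      have "cinner (\<pi> cm_one \<Omega>) \<Omega> = normalized_trace 1 (cm_one :: 2 config_matrix)"
        by (rule D(8)[OF cm_one_tensor_power])
      also have "\<dots> = 1" unfolding cm_one_monomial by (subst normalized_trace_one_leg) simp_all
      finally show ?thesis by (simp add: D(2))
    qed
    have tr2: "cinner (A (B \<Omega>)) \<Omega> = of_real (cos (\<alpha> - ?\<gamma>))"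
      unfolding A_def B_def normalized_trace_hadamard_reflection_mult[symmetric]
        D(8)[OF cm_mult_tensor_power[OF hadamard_reflection_in_tensor_power
          hadamard_reflection_in_tensor_power], symmetric]
      by (simp add: D(5) in_union)
    have "cinner (p \<xi>) \<Omega> = of_real ((1 - cos (\<alpha> - ?\<gamma>)) / 2)"
      using tr[of \<alpha>] tr[of ?\<gamma>] tr1 tr2
      by (simp add: p_def \<xi>_def blinfun.add_left blinfun.scaleR_left blinfun.diff_right
        cinner_scaleR_left cinner_add_left cinner_diff_left flip: A_def B_def)
    moreover have "cos (\<alpha> - ?\<gamma>) \<noteq> 1"
    proof -
      have "cos (\<alpha> - ?\<gamma>) = cos (2 * (\<beta> - \<alpha>))"
        using cos_minus[of "2 * (\<beta> - \<alpha>)"] by (simp add: algebra_simps)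
      also have "\<dots> = 1 - 2 * (sin (\<beta> - \<alpha>))\<^sup>2" by (rule cos_double_sin)
      finally show ?thesis using distinct by simp
    qed
    ultimately have "p \<xi> \<noteq> 0"
      using cinner_scaleC_left[of 0 "\<Omega>" \<Omega>] by (auto simp: cinner_zero_left)
    have "cinner ((E p - t *\<^sub>R p) \<xi>) \<xi> = of_real ((1/2 - t) * (norm (p \<xi>))\<^sup>2)"
    proof -
      have "(E p - t *\<^sub>R p) \<xi> = (1/2 - t) *\<^sub>R p \<xi>"
        by (simp add: E_p B\<xi> blinfun.add_left blinfun.scaleR_left blinfun.diff_left
          scaleR_add_right scaleR_left_diff_distrib)
      then show ?thesis by (simp add: cinner_scaleR_left pp cinner_self)
    qed
    moreover have "cinner ((E p - t *\<^sub>R p) \<xi>) \<xi> \<in> \<real>\<^sub>\<ge>\<^sub>0"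
      using t p_in p_pos unfolding positive_op_def by blast
    ultimately have "0 \<le> (1/2 - t) * (norm (p \<xi>))\<^sup>2"
      by (simp only: nonneg_Reals_of_real_iff)
    then show ?thesis using \<open>p \<xi> \<noteq> 0\<close> by (simp add: zero_le_mult_iff)
  qed
  ultimately show ?thesis
    unfolding pimsner_popa_constant_def cond_exp by (intro cSup_eq_maximum)
qed

theorem theorem1p3:
  fixes \<alpha> \<beta> :: real
    and \<pi> :: "2 config_matrix \<Rightarrow> ('h::complex_hilbert_space \<Rightarrow>\<^sub>L 'h)"
    and \<Omega> :: 'h
    and u v :: "complex^2^2"
  assumes gns: "gns_representation \<pi> \<Omega>"
    and \<alpha>: "0 \<le> \<alpha>" "\<alpha> < 2 * pi"
    and \<beta>: "0 \<le> \<beta>" "\<beta> < 2 * pi"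
    and distinct: "\<beta> \<notin> {\<alpha>, \<alpha> + pi, \<alpha> - pi}"
    and u: "u = phase_hadamard \<alpha>"
    and v: "v = phase_hadamard \<beta>"
  shows "pimsner_popa_constant (spin_factor \<pi>) (vector_trace \<Omega>)
           (spin_subfactor \<pi> u) (spin_subfactor \<pi> v) = 1 / 2"
  unfolding u v
proof (rule phase_hadamard_pimsner_popa[OF gns])
  show "sin (\<beta> - \<alpha>) \<noteq> 0"
  proof
    assume "sin (\<beta> - \<alpha>) = 0"
    then obtain i :: int where i: "\<beta> - \<alpha> = of_int i * pi" unfolding sin_zero_iff_int2 ..
    \<comment> \<open>Both angles lie in an interval of length \<open>2\<pi>\<close>, which leaves only the excluded multiples of \<open>\<pi>\<close>.\<close>
    have "of_int i * pi < 2 * pi" "(-2) * pi < of_int i * pi" using i \<alpha> \<beta> by linarith+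
    then have "of_int i < (2 :: real)" "-2 < (of_int i :: real)"
      by (simp_all only: mult_less_cancel_right_pos[OF pi_gt_zero])
    then have "i = -1 \<or> i = 0 \<or> i = 1" by linarith
    then show False using i distinct by auto
  qed
qed

end
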